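(* Consider the partitioned GARK scheme for separable Hamiltonians with split kinetic and potential energies $H(\mathbf p,\mathbf q)=\sum_{m=1}^N\big(T^{\{m\}}(\mathbf p)+V^{\{m\}}(\mathbf q)\big)$, regarded as a GARK scheme with $2N$ partitions ($H^{\{m\}}=T^{\{m\}}$, $H^{\{N+m\}}=V^{\{m\}}$, $m=1,\dots,N$) with coefficients $\widetilde{\mathbf A}^{\{q,m\}},\widetilde{\mathbf b}^{\{m\}}$, $q,m=1,\dots,2N$. The necessary and sufficient conditions for the symplecticity of this scheme are $$\mathbf P^{\{\ell,m\}}:=(\widetilde{\mathbf A}^{\{m,\ell\}})^{\top}\operatorname{diag}(\widetilde{\mathbf b}^{\{m\}})+\operatorname{diag}(\widetilde{\mathbf b}^{\{\ell\}})\widetilde{\mathbf A}^{\{\ell,m\}}-\widetilde{\mathbf b}^{\{\ell\}}(\widetilde{\mathbf b}^{\{m\}})^{\top}=\mathbf 0,\qquad \ell\in\{1,\dots,N\},\ m\in\{N+1,\dots,2N\}.$$ In the notation $\widehat{\mathbf A}^{\{\ell,m\}}=\widetilde{\mathbf A}^{\{\ell,N+m\}}$, $\mathbf A^{\{\ell,m\}}=\widetilde{\mathbf A}^{\{N+\ell,m\}}$, $\widehat{\mathbf b}^{\{m\}}=\widetilde{\mathbf b}^{\{N+m\}}$, $\mathbf b^{\{m\}}=\widetilde{\mathbf b}^{\{m\}}$ ($\ell,m=1,\dots,N$), $\mathbf B^{\{\ell\}}=\operatorname{diag}(\mathbf b^{\{\ell\}})$, $\widehat{\mathbf B}^{\{m\}}=\operatorname{diag}(\widehat{\mathbf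 b}^{\{m\}})$, the necessary and sufficient condition for symplecticity is $$(\widehat{\mathbf A}^{\{\ell,m\}})^{\top}\mathbf B^{\{\ell\}}+\widehat{\mathbf B}^{\{m\}}\mathbf A^{\{m,\ell\}}-\widehat{\mathbf b}^{\{m\}}(\mathbf b^{\{\ell\}})^{\top}=\mathbf 0,\qquad \ell,m=1,\dots,N.$$
   Context: Partitioned GARK scheme. Let partition $m$ of the kinetic part have $s^{\{m\}}$ stages and partition $m$ of the potential part have $\hat s^{\{m\}}$ stages, with coefficients $\mathbf A^{\{q,m\}}\in\mathbb R^{\hat s^{\{q\}}\times s^{\{m\}}}$, $\widehat{\mathbf A}^{\{q,m\}}\in\mathbb R^{s^{\{q\}}\times\hat s^{\{m\}}}$, $\mathbf b^{\{m\}}\in\mathbb R^{s^{\{m\}}}$, $\widehat{\mathbf b}^{\{m\}}\in\mathbb R^{\hat s^{\{m\}}}$. Applied to the Hamiltonian system $\mathbf p'=-H_{\mathbf q}$, $\mathbf q'=H_{\mathbf p}$ with $H=\sum_m(T^{\{m\}}(\mathbf p)+V^{\{m\}}(\mathbf q))$, one step $(\mathbf p_0,\mathbf q_0)\mapsto(\mathbf p_1,\mathbf q_1)$ is $$P_i^{\{q\}}=\mathbf p_0+h\sum_{m=1}^N\sum_{j=1}^{\hat s^{\{m\}}}\widehat a_{i,j}^{\{q,m\}}k_j^{\{m\}},\qquad Q_i^{\{q\}}=\mathbf q_0+h\sum_{m=1}^N\sum_{j=1}^{s^{\{m\}}}a_{i,j}^{\{q,m\}}\ell_j^{\{m\}},$$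 $$\mathbf p_1=\mathbf p_0+h\sum_{q=1}^N\sum_{i=1}^{\hat s^{\{q\}}}\widehat b_i^{\{q\}}k_i^{\{q\}},\qquad \mathbf q_1=\mathbf q_0+h\sum_{q=1}^N\sum_{i=1}^{s^{\{q\}}}b_i^{\{q\}}\ell_i^{\{q\}},$$ $$k_i^{\{m\}}=-V^{\{m\}}_{\mathbf q}(Q_i^{\{m\}}),\qquad \ell_i^{\{m\}}=T^{\{m\}}_{\mathbf p}(P_i^{\{m\}}).$$ This is the GARK scheme $Y_i^{\{q\}}=\mathbf y_0+h\sum_{m=1}^{2N}\sum_j\widetilde a^{\{q,m\}}_{i,j}\mathbf f^{\{m\}}(Y_j^{\{m\}})$, $\mathbf y_1=\mathbf y_0+h\sum_{q=1}^{2N}\sum_i\widetilde b_i^{\{q\}}\mathbf f^{\{q\}}(Y_i^{\{q\}})$, $\mathbf y=(\mathbf p,\mathbf q)$, for the $2N$-way splitting $\mathbf f^{\{m\}}=(0,T^{\{m\}}_{\mathbf p})$, $\mathbf f^{\{N+m\}}=(-V^{\{m\}}_{\mathbf q},0)$, $m\le N$; the blocks $\widetilde{\mathbf A}^{\{\ell,m\}}$ with $\ell,m\le N$ or $\ell,m>N$ do not influence the computation. Symplecticity. For all smooth $T^{\{m\}},V^{\{m\}}$ (and $h$ such that the stage equations are solvable) the one-step map $\Phi_h$ satisfies $(\partial\Phi_h/\partial\mathbf y_0)^\top\mathbf J^{-1}(\partial\Phi_h/\partial\mathbf y_0)=\mathbf J^{-1}$, where $\mathbf J=\begin{bmatrix}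 0 & -I \\ I & 0 \end{bmatrix}$ with $I$ the identity matrix.
   Formalization: Necessity is stated only for irreducible schemes (no nontrivial grouping of equivalent stages within partitions); with redundant stages the condition can fail for a symplectic scheme, e.g. symplectic Euler written with a duplicated kinetic stage. Sufficiency is unrestricted. *)

theory Defs
  imports "HOL-Analysis.Analysis" "Jordan_Normal_Form.Matrix"
begin

text \<open>
  Phase space vectors and Jacobians are the type-indexed vectors and matrices of HOL-Analysis
  (\<open>real ^ 'd\<close>). The coefficient arrays, whose sizes depend on the partition, are the
  \<open>carrier_vec\<close>/\<open>carrier_mat\<close> objects of Jordan_Normal_Form. To keep the two
  apart, the component of a coefficient vector is written \<open>$v\<close>.

  Partitions are numbered from 1; stages are numbered from 0, as matrix rows and columns are.
\<close>

no_notation vec_index (infixl \<open>$\<close> 100)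
no_notation scalar_prod (infix \<open>\<bullet>\<close> 70)
notation vec_index (infixl \<open>$v\<close> 100)


section \<open>Smooth functions and gradients\<close>

definition partial :: "'d \<Rightarrow> (real ^ 'd::finite \<Rightarrow> real) \<Rightarrow> real ^ 'd \<Rightarrow> real" where
  "partial a F x = frechet_derivative F (at x) (axis a 1)"

definition grad :: "(real ^ 'd::finite \<Rightarrow> real) \<Rightarrow> real ^ 'd \<Rightarrow> real ^ 'd" where
  "grad F x = (\<chi> a. partial a F x)"

fun C_k :: "nat \<Rightarrow> (real ^ 'd::finite \<Rightarrow> real) \<Rightarrow> bool" where
  "C_k 0 F \<longleftrightarrow> continuous_on UNIV F"
| "C_k (Suc k) F \<longleftrightarrow> (\<forall>x. F differentiable (at x)) \<and> (\<forall>a. C_k k (partial a F))"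

definition smooth :: "(real ^ 'd::finite \<Rightarrow> real) \<Rightarrow> bool" where
  "smooth F \<longleftrightarrow> (\<forall>k. C_k k F)"


section \<open>Phase space and symplectic maps\<close>

text \<open>The state \<open>y = (p, q)\<close> has the components of \<open>p\<close> at the indices
  \<open>Inl a\<close> and those of \<open>q\<close> at the indices \<open>Inr a\<close>.\<close>

definition pq :: "real ^ 'd \<Rightarrow> real ^ 'd \<Rightarrow> real ^ ('d::finite + 'd)" where
  "pq p q = (\<chi> r. case r of Inl a \<Rightarrow> p $ a | Inr a \<Rightarrow> q $ a)"

definition p_of :: "real ^ ('d::finite + 'd) \<Rightarrow> real ^ 'd" where
  "p_of y = (\<chi> a. y $ Inl a)"

definition q_of :: "real ^ ('d::finite + 'd) \<Rightarrow> real ^ 'd" where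
  "q_of y = (\<chi> a. y $ Inr a)"

definition symp_J :: "real ^ ('d::finite + 'd) ^ ('d + 'd)" where
  "symp_J = (\<chi> r c. case r of
      Inl a \<Rightarrow> (case c of Inl b \<Rightarrow> 0 | Inr b \<Rightarrow> if a = b then - 1 else 0)
    | Inr a \<Rightarrow> (case c of Inl b \<Rightarrow> if a = b then 1 else 0 | Inr b \<Rightarrow> 0))"

definition symplectic_at ::
    "(real ^ ('d::finite + 'd) \<Rightarrow> real ^ ('d + 'd)) \<Rightarrow> real ^ ('d + 'd) \<Rightarrow> bool" where
  "symplectic_at \<Phi> y \<longleftrightarrow> \<Phi> differentiable (at y) \<and>
     Finite_Cartesian_Product.transpose (jacobian \<Phi> (at y)) ** matrix_inv symp_J ** jacobian \<Phi> (at y)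
       = matrix_inv symp_J"


section \<open>GARK schemes\<close>

text \<open>A scheme with partitions \<open>1, \<dots>, M\<close>; partition \<open>q\<close> has
  \<open>dim_vec (b q)\<close> stages. \<open>Y q i\<close> is the \<open>i\<close>-th stage value of
  partition \<open>q\<close>.\<close>

definition gark_stages ::
    "nat \<Rightarrow> (nat \<Rightarrow> nat \<Rightarrow> real mat) \<Rightarrow> (nat \<Rightarrow> real Matrix.vec) \<Rightarrow>
     (nat \<Rightarrow> 'v \<Rightarrow> 'v) \<Rightarrow> real \<Rightarrow> 'v \<Rightarrow> (nat \<Rightarrow> nat \<Rightarrow> 'v::real_vector) \<Rightarrow> bool" where
  "gark_stages M A b f h y0 Y \<longleftrightarrow>
     (\<forall>q\<in>{1..M}. \<forall>i<dim_vec (b q).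
        Y q i = y0 + h *\<^sub>R (\<Sum>m=1..M. \<Sum>j<dim_vec (b m). (A q m $$ (i, j)) *\<^sub>R f m (Y m j)))"

definition gark_result ::
    "nat \<Rightarrow> (nat \<Rightarrow> real Matrix.vec) \<Rightarrow>
     (nat \<Rightarrow> 'v \<Rightarrow> 'v) \<Rightarrow> real \<Rightarrow> 'v \<Rightarrow> (nat \<Rightarrow> nat \<Rightarrow> 'v::real_vector) \<Rightarrow> 'v" where
  "gark_result M b f h y0 Y =
     y0 + h *\<^sub>R (\<Sum>q=1..M. \<Sum>i<dim_vec (b q). (b q $v i) *\<^sub>R f q (Y q i))"

definition hamiltonian_splitting ::
    "nat \<Rightarrow> (nat \<Rightarrow> real ^ 'd::finite \<Rightarrow> real) \<Rightarrow> (nat \<Rightarrow> real ^ 'd \<Rightarrow> real) \<Rightarrow>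
     nat \<Rightarrow> real ^ ('d + 'd) \<Rightarrow> real ^ ('d + 'd)" where
  "hamiltonian_splitting N T V m y =
     (if m \<le> N then pq 0 (grad (T m) (p_of y)) else pq (- grad (V (m - N)) (q_of y)) 0)"

text \<open>
  The schemes may be implicit, so the one-step map is given by a solution branch of the stage
  equations: stage values depending differentiably on \<open>y\<close> in an open set \<open>U\<close> of
  initial values. Symplecticity is required of every branch, for every step size. The dimension
  of the phase space enters through the \<open>itself\<close> argument.
\<close>

definition gark_symplectic ::
    "'d::finite itself \<Rightarrow> nat \<Rightarrow> (nat \<Rightarrow> nat \<Rightarrow> real mat) \<Rightarrow> (nat \<Rightarrow> real Matrix.vec) \<Rightarrow> bool" where
  "gark_symplectic _ N A b \<longleftrightarrow>
     (\<forall>(T :: nat \<Rightarrow> real ^ 'd \<Rightarrow> real) V. (\<forall>m\<in>{1..N}. smooth (T m) \<and> smooth (V m)) \<longrightarrow>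
       (\<forall>h U Y. open U \<longrightarrow>
          (\<forall>q\<in>{1..2*N}. \<forall>i<dim_vec (b q). Y q i differentiable_on U) \<longrightarrow>
          (\<forall>y\<in>U. gark_stages (2*N) A b (hamiltonian_splitting N T V) h y (\<lambda>q i. Y q i y)) \<longrightarrow>
          (\<forall>y\<in>U. symplectic_at
             (\<lambda>y. gark_result (2*N) b (hamiltonian_splitting N T V) h y (\<lambda>q i. Y q i y)) y)))"


section \<open>Partitioned GARK schemes for separable Hamiltonians\<close>

text \<open>\<open>A\<close>, \<open>b\<close>, \<open>Ah\<close>, \<open>bh\<close> are the coefficients without and with a hat.
  Partition \<open>m\<close> of the kinetic part has \<open>dim_vec (b m)\<close> stages \<open>P m i\<close>,
  partition \<open>m\<close> of the potential part has \<open>dim_vec (bh m)\<close> stages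
  \<open>Q m i\<close>.\<close>

definition pgark_stages ::
    "nat \<Rightarrow> (nat \<Rightarrow> nat \<Rightarrow> real mat) \<Rightarrow> (nat \<Rightarrow> nat \<Rightarrow> real mat) \<Rightarrow>
     (nat \<Rightarrow> real Matrix.vec) \<Rightarrow> (nat \<Rightarrow> real Matrix.vec) \<Rightarrow>
     (nat \<Rightarrow> real ^ 'd::finite \<Rightarrow> real) \<Rightarrow> (nat \<Rightarrow> real ^ 'd \<Rightarrow> real) \<Rightarrow>
     real \<Rightarrow> real ^ 'd \<Rightarrow> real ^ 'd \<Rightarrow>
     (nat \<Rightarrow> nat \<Rightarrow> real ^ 'd) \<Rightarrow> (nat \<Rightarrow> nat \<Rightarrow> real ^ 'd) \<Rightarrow> bool" where
  "pgark_stages N A Ah b bh T V h p0 q0 P Q \<longleftrightarrow>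
     (\<forall>q\<in>{1..N}. \<forall>i<dim_vec (b q).
        P q i = p0 + h *\<^sub>R (\<Sum>m=1..N. \<Sum>j<dim_vec (bh m). (Ah q m $$ (i, j)) *\<^sub>R (- grad (V m) (Q m j)))) \<and>
     (\<forall>q\<in>{1..N}. \<forall>i<dim_vec (bh q).
        Q q i = q0 + h *\<^sub>R (\<Sum>m=1..N. \<Sum>j<dim_vec (b m). (A q m $$ (i, j)) *\<^sub>R grad (T m) (P m j)))"

definition pgark_result ::
    "nat \<Rightarrow> (nat \<Rightarrow> real Matrix.vec) \<Rightarrow> (nat \<Rightarrow> real Matrix.vec) \<Rightarrow>
     (nat \<Rightarrow> real ^ 'd::finite \<Rightarrow> real) \<Rightarrow> (nat \<Rightarrow> real ^ 'd \<Rightarrow> real) \<Rightarrow>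
     real \<Rightarrow> real ^ 'd \<Rightarrow> real ^ 'd \<Rightarrow>
     (nat \<Rightarrow> nat \<Rightarrow> real ^ 'd) \<Rightarrow> (nat \<Rightarrow> nat \<Rightarrow> real ^ 'd) \<Rightarrow> real ^ ('d + 'd)" where
  "pgark_result N b bh T V h p0 q0 P Q = pq
     (p0 + h *\<^sub>R (\<Sum>q=1..N. \<Sum>i<dim_vec (bh q). (bh q $v i) *\<^sub>R (- grad (V q) (Q q i))))
     (q0 + h *\<^sub>R (\<Sum>q=1..N. \<Sum>i<dim_vec (b q). (b q $v i) *\<^sub>R grad (T q) (P q i)))"

definition pgark_symplectic ::
    "'d::finite itself \<Rightarrow> nat \<Rightarrow> (nat \<Rightarrow> nat \<Rightarrow> real mat) \<Rightarrow> (nat \<Rightarrow> nat \<Rightarrow> real mat) \<Rightarrow>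
     (nat \<Rightarrow> real Matrix.vec) \<Rightarrow> (nat \<Rightarrow> real Matrix.vec) \<Rightarrow> bool" where
  "pgark_symplectic _ N A Ah b bh \<longleftrightarrow>
     (\<forall>(T :: nat \<Rightarrow> real ^ 'd \<Rightarrow> real) V. (\<forall>m\<in>{1..N}. smooth (T m) \<and> smooth (V m)) \<longrightarrow>
       (\<forall>h U P Q. open U \<longrightarrow>
          (\<forall>q\<in>{1..N}. \<forall>i<dim_vec (b q). P q i differentiable_on U) \<longrightarrow>
          (\<forall>q\<in>{1..N}. \<forall>i<dim_vec (bh q). Q q i differentiable_on U) \<longrightarrow>
          (\<forall>y\<in>U. pgark_stages N A Ah b bh T V h (p_of y) (q_of y) (\<lambda>q i. P q i y) (\<lambda>q i. Q q i y)) \<longrightarrow>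
          (\<forall>y\<in>U. symplectic_at
             (\<lambda>y. pgark_result N b bh T V h (p_of y) (q_of y) (\<lambda>q i. P q i y) (\<lambda>q i. Q q i y)) y)))"

text \<open>
  S-irreducibility in the sense of Hairer, carried over to partitioned schemes. The stages of
  each partition are grouped into the classes of an equivalence relation (\<open>R q\<close> for the
  kinetic, \<open>S q\<close> for the potential part); if equivalent stages have the same sums of
  coefficients over every class of every partition, then a solution of the reduced scheme, with
  one stage per class, also solves the full one. The scheme is irreducible if this happens for
  the trivial grouping only. Two copies of the same stage are the simplest reducible case;
  symplecticity then only constrains the coefficients summed over the copies.
\<close>

definition pgark_reduction ::
    "nat \<Rightarrow> (nat \<Rightarrow> nat \<Rightarrow> real mat) \<Rightarrow> (nat \<Rightarrow> nat \<Rightarrow> real mat) \<Rightarrow>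
     (nat \<Rightarrow> real Matrix.vec) \<Rightarrow> (nat \<Rightarrow> real Matrix.vec) \<Rightarrow>
     (nat \<Rightarrow> nat rel) \<Rightarrow> (nat \<Rightarrow> nat rel) \<Rightarrow> bool" where
  "pgark_reduction N A Ah b bh R S \<longleftrightarrow>
     (\<forall>q\<in>{1..N}. equiv {..<dim_vec (b q)} (R q) \<and> equiv {..<dim_vec (bh q)} (S q)) \<and>
     (\<forall>q\<in>{1..N}. \<forall>m\<in>{1..N}.
        (\<forall>(i, i')\<in>R q. \<forall>C\<in>{..<dim_vec (bh m)} // S m.
           (\<Sum>j\<in>C. Ah q m $$ (i, j)) = (\<Sum>j\<in>C. Ah q m $$ (i', j))) \<and>
        (\<forall>(i, i')\<in>S q. \<forall>C\<in>{..<dim_vec (b m)} // R m.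
           (\<Sum>j\<in>C. A q m $$ (i, j)) = (\<Sum>j\<in>C. A q m $$ (i', j))))"

definition pgark_irreducible ::
    "nat \<Rightarrow> (nat \<Rightarrow> nat \<Rightarrow> real mat) \<Rightarrow> (nat \<Rightarrow> nat \<Rightarrow> real mat) \<Rightarrow>
     (nat \<Rightarrow> real Matrix.vec) \<Rightarrow> (nat \<Rightarrow> real Matrix.vec) \<Rightarrow> bool" where
  "pgark_irreducible N A Ah b bh \<longleftrightarrow>
     (\<forall>R S. pgark_reduction N A Ah b bh R S \<longrightarrow>
        (\<forall>q\<in>{1..N}. R q = Id_on {..<dim_vec (b q)} \<and> S q = Id_on {..<dim_vec (bh q)}))"


section \<open>Coefficient conditions\<close>

definition diag_of :: "real Matrix.vec \<Rightarrow> real mat" where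
  "diag_of v = mat_diag (dim_vec v) (vec_index v)"

definition outer :: "real Matrix.vec \<Rightarrow> real Matrix.vec \<Rightarrow> real mat" where
  "outer v w = mat_of_cols (dim_vec v) [v] * transpose_mat (mat_of_cols (dim_vec w) [w])"

definition gark_P ::
    "(nat \<Rightarrow> nat \<Rightarrow> real mat) \<Rightarrow> (nat \<Rightarrow> real Matrix.vec) \<Rightarrow> nat \<Rightarrow> nat \<Rightarrow> real mat" where
  "gark_P A b l m =
     transpose_mat (A m l) * diag_of (b m) + diag_of (b l) * A l m - outer (b l) (b m)"

end

theory Submission
  imports Defs
begin

text \<open>
  For the differentials of one step,
  \<open>dp\<^sub>1 \<and> dq\<^sub>1 - dp\<^sub>0 \<and> dq\<^sub>0 = - h\<^sup>2 \<Sum> M\<^sub>i\<^sub>j dk\<^sub>j \<and> d\<ell>\<^sub>i\<close>, where the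
  \<open>M\<^sub>i\<^sub>j\<close> are the entries of the coefficient conditions; the terms
  \<open>dk\<^sub>j \<and> dQ\<^sub>j\<close> and \<open>dP\<^sub>i \<and> d\<ell>\<^sub>i\<close> vanish since Hessians are symmetric. Hence the
  conditions suffice.

  Conversely, in an irreducible scheme no two stages of a partition have the same coefficient
  row, since otherwise these two could be identified. So for generic stage slopes \<open>k\<close> and
  \<open>\<ell>\<close>, prescribed independently, all stage values within a partition differ, and there are
  potentials depending on one coordinate only whose gradients take the prescribed values at the
  stages, are constant near every stage but one in the kinetic and one in the potential part,
  and are affine with nonzero slope near these two. With these potentials the step is affine
  near the origin, and only a single \<open>dk\<^sub>j \<and> d\<ell>\<^sub>i\<close>, which is nonzero, survives in the
  formula above; so \<open>M\<^sub>i\<^sub>j = 0\<close>.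
\<close>

section \<open>Symmetry of second derivatives\<close>

lemma frechet_derivative_eq_sum_partial:
  fixes G :: "real ^ 'd::finite \<Rightarrow> real"
  assumes "G differentiable (at x)"
  shows "frechet_derivative G (at x) v = (\<Sum>b\<in>UNIV. v $ b * partial b G x)"
proof -
  have lin: "linear (frechet_derivative G (at x))"
    using assms by (rule linear_frechet_derivative)
  have "frechet_derivative G (at x) v = frechet_derivative G (at x) (\<Sum>b\<in>UNIV. v $ b *\<^sub>R axis b 1)"
    using basis_expansion[of v] by (simp add: scalar_mult_eq_scaleR)
  also have "\<dots> = (\<Sum>b\<in>UNIV. v $ b * partial b G x)"
    by (simp add: linear_sum[OF lin] linear_scale[OF lin] partial_def)
  finally show ?thesis .
qed

text \<open>Restricts to coordinate lines, where the one-variable mean value theorem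
  applies.\<close>

lemma partial_DERIV_line:
  fixes G :: "real ^ 'd::finite \<Rightarrow> real"
  assumes "\<And>x. G differentiable (at x)"
  shows "((\<lambda>s. G (z + s *\<^sub>R axis a 1)) has_real_derivative partial a G (z + s *\<^sub>R axis a 1)) (at s)"
proof -
  let ?D = "frechet_derivative G (at (z + s *\<^sub>R axis a 1))"
  have G: "(G has_derivative ?D) (at (z + s *\<^sub>R axis a 1))"
    using assms frechet_derivative_works by blast
  have "((\<lambda>s. z + s *\<^sub>R axis a 1) has_derivative (\<lambda>s. s *\<^sub>R axis a 1)) (at s)"
    by (auto intro!: derivative_eq_intros)
  from has_derivative_compose[OF this G]
  show ?thesis
    by (simp add: has_field_derivative_def partial_def linear_scale[OF has_derivative_linear[OF G]]
      mult_commute_abs)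
qed

text \<open>The mean value theorem is applied twice: in direction \<open>a\<close> to the difference
  between the translate of \<open>F\<close> by \<open>h\<close> along \<open>b\<close> and
  \<open>F\<close> itself, then in direction \<open>b\<close> to \<open>partial a F\<close>. The
  second difference on the left is symmetric in \<open>a\<close> and \<open>b\<close>, so it can be
  compared with either mixed partial.\<close>

lemma second_difference_mixed_partial:
  fixes F :: "real ^ 'd::finite \<Rightarrow> real"
  assumes F: "\<And>x. F differentiable (at x)" and F': "\<And>x. partial a F differentiable (at x)"
    and "0 < h"
  obtains \<xi> \<eta> where "0 < \<xi>" "\<xi> < h" "0 < \<eta>" "\<eta> < h"
    "F (x + h *\<^sub>R axis a 1 + h *\<^sub>R axis b 1) - F (x + h *\<^sub>R axis a 1) - F (x + h *\<^sub>R axis b 1) + F x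
      = h * (h * partial b (partial a F) (x + \<xi> *\<^sub>R axis a 1 + \<eta> *\<^sub>R axis b 1))"
proof -
  let ?a = "axis a 1 :: real ^ 'd" and ?b = "axis b 1 :: real ^ 'd"
  have "((\<lambda>s. F ((x + h *\<^sub>R ?b) + s *\<^sub>R ?a) - F (x + s *\<^sub>R ?a)) has_real_derivative
      partial a F ((x + h *\<^sub>R ?b) + s *\<^sub>R ?a) - partial a F (x + s *\<^sub>R ?a)) (at s)" for s
    by (intro DERIV_diff partial_DERIV_line F)
  from MVT2[OF \<open>0 < h\<close> this] obtain \<xi> where \<xi>: "0 < \<xi>" "\<xi> < h"
    "F ((x + h *\<^sub>R ?b) + h *\<^sub>R ?a) - F (x + h *\<^sub>R ?a) - (F (x + h *\<^sub>R ?b) - F x) =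
      h * (partial a F ((x + h *\<^sub>R ?b) + \<xi> *\<^sub>R ?a) - partial a F (x + \<xi> *\<^sub>R ?a))"
    by auto
  from MVT2[OF \<open>0 < h\<close> partial_DERIV_line[OF F', of "x + \<xi> *\<^sub>R ?a" b]] obtain \<eta> where \<eta>: "0 < \<eta>" "\<eta> < h"
    "partial a F ((x + \<xi> *\<^sub>R ?a) + h *\<^sub>R ?b) - partial a F (x + \<xi> *\<^sub>R ?a) =
      h * partial b (partial a F) (x + \<xi> *\<^sub>R ?a + \<eta> *\<^sub>R ?b)"
    by auto
  have "F (x + h *\<^sub>R ?a + h *\<^sub>R ?b) - F (x + h *\<^sub>R ?a) - F (x + h *\<^sub>R ?b) + F x
      = h * (h * partial b (partial a F) (x + \<xi> *\<^sub>R ?a + \<eta> *\<^sub>R ?b))"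
    using \<xi>(3) \<eta>(3) by (simp add: add_ac)
  with \<xi> \<eta> show thesis by (intro that) auto
qed

text \<open>Schwarz's theorem. One symmetric second difference equals \<open>h * h\<close> times
  either mixed partial, taken at points near \<open>x\<close>; continuity then excludes different
  values at \<open>x\<close>.\<close>

lemma mixed_partials_commute:
  fixes F :: "real ^ 'd::finite \<Rightarrow> real"
  assumes F: "\<And>x. F differentiable (at x)" and F': "\<And>a x. partial a F differentiable (at x)"
    and cont: "\<And>a b. continuous_on UNIV (partial a (partial b F))"
  shows "partial a (partial b F) x = partial b (partial a F) x"
proof (rule ccontr)
  let ?a = "axis a 1 :: real ^ 'd" and ?b = "axis b 1 :: real ^ 'd"
  let ?f = "partial b (partial a F)" and ?g = "partial a (partial b F)"
  assume "?g x \<noteq> ?f x"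
  define e where "e = \<bar>?g x - ?f x\<bar> / 2"
  have e: "0 < e" using \<open>?g x \<noteq> ?f x\<close> by (simp add: e_def)
  obtain d1 where d1: "0 < d1" "\<And>z. dist z x < d1 \<Longrightarrow> dist (?f z) (?f x) < e"
    using cont[of b a] e by (meson UNIV_I continuous_on_iff)
  obtain d2 where d2: "0 < d2" "\<And>z. dist z x < d2 \<Longrightarrow> dist (?g z) (?g x) < e"
    using cont[of a b] e by (meson UNIV_I continuous_on_iff)
  \<comment> \<open>Each intermediate point is displaced by less than \<open>h\<close> along two
    axes, so it lies within \<open>2 * h\<close> of \<open>x\<close>.\<close>
  define h where "h = min d1 d2 / 2"
  have h: "0 < h" "2 * h \<le> d1" "2 * h \<le> d2" using d1 d2 by (auto simp: h_def)
  have near: "dist (x + \<xi> *\<^sub>R axis i 1 + \<eta> *\<^sub>R axis j 1) x < 2 * h"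
    if "0 < \<xi>" "\<xi> < h" "0 < \<eta>" "\<eta> < h" for \<xi> \<eta> and i j :: 'd
  proof -
    have "norm (\<xi> *\<^sub>R axis i 1 + \<eta> *\<^sub>R axis j 1 :: real ^ 'd)
        \<le> norm (\<xi> *\<^sub>R axis i 1 :: real ^ 'd) + norm (\<eta> *\<^sub>R axis j 1 :: real ^ 'd)"
      by (rule norm_triangle_ineq)
    also have "\<dots> < 2 * h" using that by (simp add: norm_axis_1)
    finally show ?thesis by (simp add: dist_norm add.assoc)
  qed
  obtain \<xi> \<eta> where 1: "0 < \<xi>" "\<xi> < h" "0 < \<eta>" "\<eta> < h"
    "F (x + h *\<^sub>R ?a + h *\<^sub>R ?b) - F (x + h *\<^sub>R ?a) - F (x + h *\<^sub>R ?b) + F x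
      = h * (h * ?f (x + \<xi> *\<^sub>R ?a + \<eta> *\<^sub>R ?b))"
    by (rule second_difference_mixed_partial[OF F F' h(1)])
  obtain \<xi>' \<eta>' where 2: "0 < \<xi>'" "\<xi>' < h" "0 < \<eta>'" "\<eta>' < h"
    "F (x + h *\<^sub>R ?b + h *\<^sub>R ?a) - F (x + h *\<^sub>R ?b) - F (x + h *\<^sub>R ?a) + F x
      = h * (h * ?g (x + \<xi>' *\<^sub>R ?b + \<eta>' *\<^sub>R ?a))"
    by (rule second_difference_mixed_partial[OF F F' h(1)])
  have "h * (h * ?f (x + \<xi> *\<^sub>R ?a + \<eta> *\<^sub>R ?b)) = h * (h * ?g (x + \<xi>' *\<^sub>R ?b + \<eta>' *\<^sub>R ?a))"
    unfolding 1(5)[symmetric] 2(5)[symmetric] by (simp add: algebra_simps)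
  then have "?f (x + \<xi> *\<^sub>R ?a + \<eta> *\<^sub>R ?b) = ?g (x + \<xi>' *\<^sub>R ?b + \<eta>' *\<^sub>R ?a)"
    using h(1) by simp
  moreover have "\<bar>?f (x + \<xi> *\<^sub>R ?a + \<eta> *\<^sub>R ?b) - ?f x\<bar> < e"
    using d1(2) near[OF 1(1-4), of a b] h unfolding dist_real_def by fastforce
  moreover have "\<bar>?g (x + \<xi>' *\<^sub>R ?b + \<eta>' *\<^sub>R ?a) - ?g x\<bar> < e"
    using d2(2) near[OF 2(1-4), of b a] h unfolding dist_real_def by fastforce
  ultimately have "\<bar>?g x - ?f x\<bar> < e + e"
    by (smt (verit))
  then show False by (simp add: e_def)
qed

text \<open>\<open>H\<close> is the Hessian, assembled from the second partials, and its
  self-adjointness is the commutation of mixed partials. In this form it cancels the pairing of a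
  stage differential with the differential of its own slope.\<close>

lemma smooth_grad_has_symmetric_derivative:
  fixes F :: "real ^ 'd::finite \<Rightarrow> real"
  assumes "smooth F"
  shows "\<exists>H. (grad F has_derivative H) (at x) \<and> (\<forall>v w. H v \<bullet> w = v \<bullet> H w)"
proof -
  have "C_k (Suc (Suc 0)) F" using assms unfolding smooth_def by blast
  then have F: "\<And>x. F differentiable (at x)" "\<And>a x. partial a F differentiable (at x)"
    "\<And>a b. continuous_on UNIV (partial a (partial b F))"
    by auto
  define H where "H v = (\<chi> a. \<Sum>b\<in>UNIV. v $ b * partial b (partial a F) x)" for v :: "real ^ 'd"
  have "(grad F has_derivative H) (at x)"
  proof (subst has_derivative_componentwise_within, intro ballI)
    fix i :: "real ^ 'd" assume "i \<in> Basis"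
    then obtain a where a: "i = axis a 1" by (auto simp: Basis_vec_def)
    have "(partial a F has_derivative frechet_derivative (partial a F) (at x)) (at x)"
      using F(2) frechet_derivative_works by blast
    moreover have "frechet_derivative (partial a F) (at x) = (\<lambda>v. H v \<bullet> i)"
      by (simp add: fun_eq_iff frechet_derivative_eq_sum_partial[OF F(2)] H_def a inner_axis)
    ultimately show "((\<lambda>x. grad F x \<bullet> i) has_derivative (\<lambda>v. H v \<bullet> i)) (at x)"
      by (simp add: a grad_def inner_axis)
  qed
  moreover have "H v \<bullet> w = v \<bullet> H w" for v w
  proof -
    have "H v \<bullet> w = (\<Sum>a\<in>UNIV. \<Sum>b\<in>UNIV. v $ b * partial b (partial a F) x * w $ a)"
      by (simp add: H_def inner_vec_def sum_distrib_right)
    also have "\<dots> = (\<Sum>b\<in>UNIV. \<Sum>a\<in>UNIV. v $ b * partial a (partial b F) x * w $ a)"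
      by (subst sum.swap) (simp add: mixed_partials_commute[OF F])
    also have "\<dots> = v \<bullet> H w"
      by (simp add: H_def inner_vec_def sum_distrib_left mult_ac)
    finally show ?thesis .
  qed
  ultimately show ?thesis by blast
qed

section \<open>The symplectic form\<close>

lemma p_of_pq [simp]: "p_of (pq p q) = p" and q_of_pq [simp]: "q_of (pq p q) = q"
  by (simp_all add: p_of_def q_of_def pq_def Finite_Cartesian_Product.vec_eq_iff)

lemma pq_p_of_q_of [simp]: "pq (p_of y) (q_of y) = y"
  by (simp add: p_of_def q_of_def pq_def Finite_Cartesian_Product.vec_eq_iff split: sum.split)

lemma p_of_simps [simp]: "p_of (x + y) = p_of x + p_of y" "p_of (c *\<^sub>R x) = c *\<^sub>R p_of x"
  "p_of (\<Sum>i\<in>I. f i) = (\<Sum>i\<in>I. p_of (f i))" "p_of 0 = 0" "p_of (- x) = - p_of x"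
  by (simp_all add: p_of_def Finite_Cartesian_Product.vec_eq_iff)

lemma q_of_simps [simp]: "q_of (x + y) = q_of x + q_of y" "q_of (c *\<^sub>R x) = c *\<^sub>R q_of x"
  "q_of (\<Sum>i\<in>I. f i) = (\<Sum>i\<in>I. q_of (f i))" "q_of 0 = 0" "q_of (- x) = - q_of x"
  by (simp_all add: q_of_def Finite_Cartesian_Product.vec_eq_iff)

lemma minus_pq [simp]: "- pq p q = pq (- p) (- q)"
  by (simp add: pq_def Finite_Cartesian_Product.vec_eq_iff split: sum.split)

lemma add_pq: "y + pq p q = pq (p_of y + p) (q_of y + q)"
  by (simp add: pq_def p_of_def q_of_def Finite_Cartesian_Product.vec_eq_iff split: sum.split)

lemma scaleR_pq: "c *\<^sub>R pq p q = pq (c *\<^sub>R p) (c *\<^sub>R q)"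
  by (simp add: pq_def Finite_Cartesian_Product.vec_eq_iff split: sum.split)

lemma sum_pq: "(\<Sum>i\<in>I. pq (f i) (g i)) = pq (\<Sum>i\<in>I. f i) (\<Sum>i\<in>I. g i)"
  by (simp add: pq_def Finite_Cartesian_Product.vec_eq_iff split: sum.split)

lemma bounded_linear_p_of: "bounded_linear p_of" and bounded_linear_q_of: "bounded_linear q_of"
  by (simp_all add: linear_conv_bounded_linear[symmetric] linear_iff)

lemma bounded_linear_pq: "bounded_linear (\<lambda>z. pq (fst z) (snd z))"
  unfolding linear_conv_bounded_linear[symmetric]
  by (simp add: linear_iff pq_def Finite_Cartesian_Product.vec_eq_iff split: sum.split)

lemmas p_of_has_derivative =
  bounded_linear.has_derivative[OF bounded_linear_p_of]
lemmas q_of_has_derivative =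
  bounded_linear.has_derivative[OF bounded_linear_q_of]

lemma pq_has_derivative:
  assumes "(f has_derivative f') (at x within S)" "(g has_derivative g') (at x within S)"
  shows "((\<lambda>x. pq (f x) (g x)) has_derivative (\<lambda>x. pq (f' x) (g' x))) (at x within S)"
  using bounded_linear.has_derivative[OF bounded_linear_pq has_derivative_Pair[OF assms]] by simp

text \<open>The canonical two-form, the sum of \<open>dp \<and> dq\<close> over the coordinates; as
  a bilinear form it has the matrix \<open>matrix_inv symp_J\<close>.\<close>

definition symp_form :: "real ^ ('d::finite + 'd) \<Rightarrow> real ^ ('d + 'd) \<Rightarrow> real" where
  "symp_form u v = p_of u \<bullet> q_of v - q_of u \<bullet> p_of v"

lemma inner_p_of_q_of: "u \<bullet> v = p_of u \<bullet> p_of v + q_of u \<bullet> q_of v"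
proof -
  have "u \<bullet> v = (\<Sum>r\<in>range Inl \<union> range Inr. u $ r * v $ r)"
    by (simp add: inner_vec_def UNIV_sum)
  also have "\<dots> = p_of u \<bullet> p_of v + q_of u \<bullet> q_of v"
    by (subst sum.union_disjoint) (auto simp: inner_vec_def p_of_def q_of_def sum.reindex)
  finally show ?thesis .
qed

lemma symp_J_mult: "symp_J *v v = pq (- q_of v) (p_of v)"
proof -
  have "(\<Sum>c\<in>UNIV. symp_J $ r $ c * v $ c) = pq (- q_of v) (p_of v) $ r" for r
  proof -
    have "(\<Sum>c\<in>UNIV. symp_J $ r $ c * v $ c) =
      (\<Sum>b\<in>UNIV. symp_J $ r $ Inl b * v $ Inl b) + (\<Sum>b\<in>UNIV. symp_J $ r $ Inr b * v $ Inr b)"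
      unfolding UNIV_sum
      by (subst sum.union_disjoint) (auto simp: sum.reindex)
    also have "\<dots> = pq (- q_of v) (p_of v) $ r"
      by (cases r) (auto simp: symp_J_def pq_def p_of_def q_of_def if_distrib[of "\<lambda>x. x * _"]
        sum_negf cong: if_cong)
    finally show ?thesis .
  qed
  then show ?thesis by (simp add: matrix_vector_mult_def Finite_Cartesian_Product.vec_eq_iff)
qed

lemma uminus_matrix_vector_mult: "(- A) *v v = - (A *v (v :: 'a::ring_1 ^ 'n))"
  by (simp add: matrix_vector_mult_def Finite_Cartesian_Product.vec_eq_iff sum_negf)

text \<open>\<open>symp_J\<close> maps \<open>(p, q)\<close> to \<open>(- q, p)\<close>; this map
  squares to minus the identity, so \<open>- symp_J\<close> is a two-sided inverse.\<close>

lemma matrix_inv_symp_J: "matrix_inv symp_J = - (symp_J :: real ^ ('d::finite + 'd) ^ ('d + 'd))"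
proof -
  have "symp_J ** (- symp_J) *v v = Finite_Cartesian_Product.mat 1 *v v" for v :: "real ^ ('d::finite + 'd)"
    by (simp flip: matrix_vector_mul_assoc add: symp_J_mult uminus_matrix_vector_mult)
  moreover have "(- symp_J) ** symp_J *v v = Finite_Cartesian_Product.mat 1 *v v" for v :: "real ^ ('d::finite + 'd)"
    by (simp flip: matrix_vector_mul_assoc add: symp_J_mult uminus_matrix_vector_mult)
  ultimately have "symp_J ** (- symp_J) = (Finite_Cartesian_Product.mat 1 :: real ^ ('d + 'd) ^ ('d + 'd))"
     "(- symp_J) ** symp_J = (Finite_Cartesian_Product.mat 1 :: real ^ ('d + 'd) ^ ('d + 'd))"
    by (auto simp: matrix_eq)
  \<comment> \<open>\<open>matrix_inv\<close> is a choice among inverses, so an inverse must be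
    known to exist before its defining equation can be used.\<close>
  then have "invertible (symp_J :: real ^ ('d + 'd) ^ ('d + 'd))"
    by (auto simp: invertible_def)
  then have "matrix_inv symp_J ** symp_J = (Finite_Cartesian_Product.mat 1 :: real ^ ('d + 'd) ^ ('d + 'd))"
    unfolding matrix_inv_def invertible_def by (metis (mono_tags, lifting) someI_ex)
  with \<open>symp_J ** (- symp_J) = Finite_Cartesian_Product.mat 1\<close> show ?thesis
    by (metis matrix_mul_assoc matrix_mul_lid matrix_mul_rid)
qed

text \<open>Two matrices are equal iff they define the same bilinear form, and the Jacobian acts on
  vectors as \<open>D\<close>. This trades matrix products for the preservation of
  \<open>symp_form\<close> by a derivative.\<close>

lemma symplectic_at_iff:
  assumes "(\<Phi> has_derivative D) (at y)"
  shows "symplectic_at \<Phi> y \<longleftrightarrow> (\<forall>u v. symp_form (D u) (D v) = symp_form u v)"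
proof -
  let ?M = "jacobian \<Phi> (at y)" and ?K = "matrix_inv (symp_J :: real ^ ('a + 'a) ^ ('a + 'a))"
  have diff: "\<Phi> differentiable (at y)" using assms by (auto simp: differentiable_def)
  have M: "?M *v u = D u" for u
    using jacobian_works[THEN iffD1, OF diff] has_derivative_unique[OF assms] by metis
  have K: "u \<bullet> (?K *v v) = symp_form u v" for u v
    by (simp add: matrix_inv_symp_J uminus_matrix_vector_mult symp_J_mult inner_p_of_q_of symp_form_def)
  have transpose: "u \<bullet> (Finite_Cartesian_Product.transpose ?M *v w) = (?M *v u) \<bullet> w" for u w
    by (simp add: dot_lmul_matrix[symmetric] inner_commute)
  have MKM: "u \<bullet> ((Finite_Cartesian_Product.transpose ?M ** ?K ** ?M) *v v) = symp_form (D u) (D v)" for u v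
    by (simp flip: matrix_vector_mul_assoc add: M K transpose del: transpose_matrix_vector)
  have "Finite_Cartesian_Product.transpose ?M ** ?K ** ?M = ?K \<longleftrightarrow>
      (\<forall>u v. u \<bullet> ((Finite_Cartesian_Product.transpose ?M ** ?K ** ?M) *v v) = u \<bullet> (?K *v v))"
    by (metis matrix_eq vector_eq_ldot)
  then show ?thesis
    by (simp add: symplectic_at_def diff MKM K)
qed

section \<open>Sufficiency\<close>

text \<open>The algebra behind sufficiency. Unprimed and primed letters are the differentials in two
  directions \<open>u\<close> and \<open>v\<close>, where \<open>up\<close>, \<open>uq\<close>,
  \<open>vp\<close>, \<open>vq\<close> are the components of these directions. The assumptions on
  \<open>P\<close> and \<open>Q\<close> are the linearized stage equations, those on
  \<open>L\<close> and \<open>K\<close> the symmetry of the Hessians.\<close>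

lemma two_form_identity:
  fixes P P' L L' :: "'i \<Rightarrow> 'v::real_inner" and Q Q' K K' :: "'j \<Rightarrow> 'v" and b :: "'i \<Rightarrow> real"
  assumes P: "\<And>i. i \<in> I \<Longrightarrow> P i = up + h *\<^sub>R (\<Sum>j\<in>J. ah i j *\<^sub>R K j)"
    and P': "\<And>i. i \<in> I \<Longrightarrow> P' i = vp + h *\<^sub>R (\<Sum>j\<in>J. ah i j *\<^sub>R K' j)"
    and Q: "\<And>j. j \<in> J \<Longrightarrow> Q j = uq + h *\<^sub>R (\<Sum>i\<in>I. a j i *\<^sub>R L i)"
    and Q': "\<And>j. j \<in> J \<Longrightarrow> Q' j = vq + h *\<^sub>R (\<Sum>i\<in>I. a j i *\<^sub>R L' i)"
    and L: "\<And>i. i \<in> I \<Longrightarrow> L i \<bullet> P' i = P i \<bullet> L' i"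
    and K: "\<And>j. j \<in> J \<Longrightarrow> K j \<bullet> Q' j = Q j \<bullet> K' j"
    and M: "\<And>i j. i \<in> I \<Longrightarrow> j \<in> J \<Longrightarrow> ah i j * b i + bh j * a j i - bh j * b i = 0"
  shows "(up + h *\<^sub>R (\<Sum>j\<in>J. bh j *\<^sub>R K j)) \<bullet> (vq + h *\<^sub>R (\<Sum>i\<in>I. b i *\<^sub>R L' i))
       - (uq + h *\<^sub>R (\<Sum>i\<in>I. b i *\<^sub>R L i)) \<bullet> (vp + h *\<^sub>R (\<Sum>j\<in>J. bh j *\<^sub>R K' j))
       = up \<bullet> vq - uq \<bullet> vp"
proof -
  \<comment> \<open>\<open>X i j\<close> is the value of
    \<open>dk\<^sub>j \<and> d\<ell>\<^sub>i\<close> on the two directions; every term below is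
    reduced to these.\<close>
  define X where "X i j = K j \<bullet> L' i - L i \<bullet> K' j" for i j
  \<comment> \<open>The stage equation is solved for the initial differential; the stage
    differentials then cancel by Hessian symmetry.\<close>
  have 1: "up \<bullet> L' i - L i \<bullet> vp = - h * (\<Sum>j\<in>J. ah i j * X i j)" if i: "i \<in> I" for i
  proof -
    have "up = P i - h *\<^sub>R (\<Sum>j\<in>J. ah i j *\<^sub>R K j)" "vp = P' i - h *\<^sub>R (\<Sum>j\<in>J. ah i j *\<^sub>R K' j)"
      using P[OF i] P'[OF i] by auto
    then show ?thesis
      by (simp add: inner_diff_left inner_diff_right inner_sum_left inner_sum_right L[OF i] X_def
          right_diff_distrib sum_subtractf)
  qed
  have 2: "K j \<bullet> vq - uq \<bullet> K' j = - h * (\<Sum>i\<in>I. a j i * X i j)" if j: "j \<in> J" for j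
  proof -
    have "uq = Q j - h *\<^sub>R (\<Sum>i\<in>I. a j i *\<^sub>R L i)" "vq = Q' j - h *\<^sub>R (\<Sum>i\<in>I. a j i *\<^sub>R L' i)"
      using Q[OF j] Q'[OF j] by auto
    then show ?thesis
      by (simp add: inner_diff_left inner_diff_right inner_sum_left inner_sum_right K[OF j] X_def
          right_diff_distrib sum_subtractf)
  qed
  define Kb Kb' Lb Lb' where "Kb = (\<Sum>j\<in>J. bh j *\<^sub>R K j)" and "Kb' = (\<Sum>j\<in>J. bh j *\<^sub>R K' j)"
    and "Lb = (\<Sum>i\<in>I. b i *\<^sub>R L i)" and "Lb' = (\<Sum>i\<in>I. b i *\<^sub>R L' i)"
  note b_defs = Kb_def Kb'_def Lb_def Lb'_def
  have 3: "up \<bullet> Lb' - Lb \<bullet> vp = - h * (\<Sum>i\<in>I. \<Sum>j\<in>J. ah i j * b i * X i j)"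
  proof -
    have "up \<bullet> Lb' - Lb \<bullet> vp = (\<Sum>i\<in>I. b i * (up \<bullet> L' i - L i \<bullet> vp))"
      by (simp add: b_defs inner_sum_left inner_sum_right right_diff_distrib sum_subtractf)
    also have "\<dots> = - h * (\<Sum>i\<in>I. \<Sum>j\<in>J. ah i j * b i * X i j)"
      by (simp add: 1 sum_distrib_left sum_negf mult_ac)
    finally show ?thesis .
  qed
  have 4: "Kb \<bullet> vq - uq \<bullet> Kb' = - h * (\<Sum>i\<in>I. \<Sum>j\<in>J. bh j * a j i * X i j)"
  proof -
    have "Kb \<bullet> vq - uq \<bullet> Kb' = (\<Sum>j\<in>J. bh j * (K j \<bullet> vq - uq \<bullet> K' j))"
      by (simp add: b_defs inner_sum_left inner_sum_right right_diff_distrib sum_subtractf)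
    also have "\<dots> = - h * (\<Sum>j\<in>J. \<Sum>i\<in>I. bh j * a j i * X i j)"
      by (simp add: 2 sum_distrib_left sum_negf mult_ac)
    also have "(\<Sum>j\<in>J. \<Sum>i\<in>I. bh j * a j i * X i j) = (\<Sum>i\<in>I. \<Sum>j\<in>J. bh j * a j i * X i j)"
      by (rule sum.swap)
    finally show ?thesis .
  qed
  have 5: "Kb \<bullet> Lb' - Lb \<bullet> Kb' = (\<Sum>i\<in>I. \<Sum>j\<in>J. bh j * b i * X i j)"
  proof -
    have "Kb \<bullet> Lb' = (\<Sum>i\<in>I. \<Sum>j\<in>J. bh j * b i * (K j \<bullet> L' i))"
      by (simp add: b_defs inner_sum_left inner_sum_right sum_distrib_left mult_ac)
    moreover have "Lb \<bullet> Kb' = (\<Sum>j\<in>J. \<Sum>i\<in>I. bh j * b i * (L i \<bullet> K' j))"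
      by (simp add: b_defs inner_sum_left inner_sum_right sum_distrib_left mult_ac)
    moreover have "\<dots> = (\<Sum>i\<in>I. \<Sum>j\<in>J. bh j * b i * (L i \<bullet> K' j))"
      by (rule sum.swap)
    ultimately show ?thesis
      by (simp add: X_def right_diff_distrib sum_subtractf)
  qed
  have "(\<Sum>i\<in>I. \<Sum>j\<in>J. ah i j * b i * X i j) + (\<Sum>i\<in>I. \<Sum>j\<in>J. bh j * a j i * X i j)
      - (\<Sum>i\<in>I. \<Sum>j\<in>J. bh j * b i * X i j)
      = (\<Sum>i\<in>I. \<Sum>j\<in>J. (ah i j * b i + bh j * a j i - bh j * b i) * X i j)"
    by (simp add: distrib_right left_diff_distrib sum.distrib sum_subtractf)
  then have 6: "(\<Sum>i\<in>I. \<Sum>j\<in>J. bh j * b i * X i j)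
      = (\<Sum>i\<in>I. \<Sum>j\<in>J. ah i j * b i * X i j) + (\<Sum>i\<in>I. \<Sum>j\<in>J. bh j * a j i * X i j)"
    using M by simp
  \<comment> \<open>The two terms linear in \<open>h\<close> become multiples of
    \<open>h * h\<close> by 3 and 4, and they cancel the quadratic term by 6.\<close>
  have "(up + h *\<^sub>R Kb) \<bullet> (vq + h *\<^sub>R Lb') - (uq + h *\<^sub>R Lb) \<bullet> (vp + h *\<^sub>R Kb')
      = up \<bullet> vq - uq \<bullet> vp + h * (up \<bullet> Lb' - Lb \<bullet> vp) + h * (Kb \<bullet> vq - uq \<bullet> Kb')
        + h * (h * (Kb \<bullet> Lb' - Lb \<bullet> Kb'))"
    by (simp add: inner_add_left inner_add_right right_diff_distrib distrib_left)
  also have "\<dots> = up \<bullet> vq - uq \<bullet> vp"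
    unfolding 3 4 5 6 by (simp add: distrib_left)
  finally show ?thesis unfolding b_defs .
qed

text \<open>Permits differentiating the stage equations, which hold only on the open set of
  admissible initial values.\<close>

lemma has_derivative_unique_on_open:
  assumes "(f has_derivative D) (at y)" "(g has_derivative E) (at y)" "open U" "y \<in> U"
    "\<And>z. z \<in> U \<Longrightarrow> f z = g z"
  shows "D = E"
proof -
  have "(g has_derivative D) (at y)"
    using assms(1,3-5) by (rule has_derivative_transform_within_open)
  then show ?thesis using assms(2) by (rule has_derivative_unique)
qed

text \<open>Differentiating the stage equations along a solution branch gives the linear relations
  of \<open>two_form_identity\<close>, with the pairs (partition, stage) as indices.\<close>

lemma pgark_symplecticI:
  assumes M: "\<And>l m i j. l \<in> {1..N} \<Longrightarrow> m \<in> {1..N} \<Longrightarrow> i < dim_vec (b l) \<Longrightarrow> j < dim_vec (bh m) \<Longrightarrow>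
    Ah l m $$ (i, j) * b l $v i + bh m $v j * A m l $$ (j, i) - bh m $v j * b l $v i = 0"
  shows "pgark_symplectic TYPE('d::finite) N A Ah b bh"
  unfolding pgark_symplectic_def
proof (intro allI impI ballI)
  fix T V :: "nat \<Rightarrow> real ^ 'd \<Rightarrow> real" and h :: real and U :: "(real ^ ('d + 'd)) set"
    and P Q :: "nat \<Rightarrow> nat \<Rightarrow> real ^ ('d + 'd) \<Rightarrow> real ^ 'd" and y
  assume smooth: "\<forall>m\<in>{1..N}. smooth (T m) \<and> smooth (V m)" and U: "open U" and y: "y \<in> U"
    and P: "\<forall>q\<in>{1..N}. \<forall>i<dim_vec (b q). P q i differentiable_on U"
    and Q: "\<forall>q\<in>{1..N}. \<forall>i<dim_vec (bh q). Q q i differentiable_on U"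
    and stages: "\<forall>y\<in>U. pgark_stages N A Ah b bh T V h (p_of y) (q_of y) (\<lambda>q i. P q i y) (\<lambda>q i. Q q i y)"
  define I where "I = Sigma {1..N} (\<lambda>q. {..<dim_vec (b q)})"
  define J where "J = Sigma {1..N} (\<lambda>q. {..<dim_vec (bh q)})"
  have sumI: "(\<Sum>m=1..N. \<Sum>i<dim_vec (b m). f m i) = (\<Sum>r\<in>I. f (fst r) (snd r))"
    for f :: "nat \<Rightarrow> nat \<Rightarrow> real ^ 'd"
    unfolding I_def by (subst sum.Sigma) (auto simp: case_prod_unfold)
  have sumJ: "(\<Sum>m=1..N. \<Sum>i<dim_vec (bh m). f m i) = (\<Sum>r\<in>J. f (fst r) (snd r))"
    for f :: "nat \<Rightarrow> nat \<Rightarrow> real ^ 'd"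
    unfolding J_def by (subst sum.Sigma) (auto simp: case_prod_unfold)
  define DP where "DP r = frechet_derivative (P (fst r) (snd r)) (at y)" for r
  have DP: "(P (fst r) (snd r) has_derivative DP r) (at y)" if "r \<in> I" for r
  proof -
    have "P (fst r) (snd r) differentiable_on U" using P that by (auto simp: I_def)
    then have "P (fst r) (snd r) differentiable (at y)"
      using U y by (simp add: differentiable_on_eq_differentiable_at)
    then show ?thesis unfolding DP_def by (simp add: frechet_derivative_works)
  qed
  define DQ where "DQ r = frechet_derivative (Q (fst r) (snd r)) (at y)" for r
  have DQ: "(Q (fst r) (snd r) has_derivative DQ r) (at y)" if "r \<in> J" for r
  proof -
    have "Q (fst r) (snd r) differentiable_on U" using Q that by (auto simp: J_def)
    then have "Q (fst r) (snd r) differentiable (at y)"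
      using U y by (simp add: differentiable_on_eq_differentiable_at)
    then show ?thesis unfolding DQ_def by (simp add: frechet_derivative_works)
  qed
  \<comment> \<open>One Hessian is chosen per stage, since stages of the same partition evaluate the
    gradient at different points.\<close>
  have "\<forall>r\<in>I. \<exists>H. (grad (T (fst r)) has_derivative H) (at (P (fst r) (snd r) y)) \<and> (\<forall>v w. H v \<bullet> w = v \<bullet> H w)"
    using smooth by (intro ballI smooth_grad_has_symmetric_derivative) (auto simp: I_def)
  from bchoice[OF this] obtain HT where
    HT: "\<And>r. r \<in> I \<Longrightarrow> (grad (T (fst r)) has_derivative HT r) (at (P (fst r) (snd r) y))"
      "\<And>r v w. r \<in> I \<Longrightarrow> HT r v \<bullet> w = v \<bullet> HT r w"
    by auto
  have "\<forall>r\<in>J. \<exists>H. (grad (V (fst r)) has_derivative H) (at (Q (fst r) (snd r) y)) \<and> (\<forall>v w. H v \<bullet> w = v \<bullet> H w)"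
    using smooth by (intro ballI smooth_grad_has_symmetric_derivative) (auto simp: J_def)
  from bchoice[OF this] obtain HV where
    HV: "\<And>r. r \<in> J \<Longrightarrow> (grad (V (fst r)) has_derivative HV r) (at (Q (fst r) (snd r) y))"
      "\<And>r v w. r \<in> J \<Longrightarrow> HV r v \<bullet> w = v \<bullet> HV r w"
    by auto
  \<comment> \<open>Differentials of the stage slopes in direction \<open>u\<close>; the sign in
    \<open>K\<close> comes from \<open>k = - grad V\<close>.\<close>
  define L where "L u r = HT r (DP r u)" for u r
  define K where "K u r = - HV r (DQ r u)" for u r
  have L: "((\<lambda>z. grad (T (fst r)) (P (fst r) (snd r) z)) has_derivative (\<lambda>u. L u r)) (at y)"
    if "r \<in> I" for r
    unfolding L_def by (rule has_derivative_compose[OF DP HT(1)]) (fact that)+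
  have K: "((\<lambda>z. - grad (V (fst r)) (Q (fst r) (snd r) z)) has_derivative (\<lambda>u. K u r)) (at y)"
    if "r \<in> J" for r
    unfolding K_def by (rule has_derivative_minus[OF has_derivative_compose[OF DQ HV(1)]]) (fact that)+
  have DP_eq: "DP r u = p_of u + h *\<^sub>R (\<Sum>s\<in>J. Ah (fst r) (fst s) $$ (snd r, snd s) *\<^sub>R K u s)" if r: "r \<in> I" for r u
  proof -
    have "DP r = (\<lambda>u. p_of u + h *\<^sub>R (\<Sum>s\<in>J. Ah (fst r) (fst s) $$ (snd r, snd s) *\<^sub>R K u s))"
    proof (rule has_derivative_unique_on_open[OF DP[OF r] _ U y])
      show "((\<lambda>z. p_of z + h *\<^sub>R (\<Sum>s\<in>J. Ah (fst r) (fst s) $$ (snd r, snd s) *\<^sub>R - grad (V (fst s)) (Q (fst s) (snd s) z)))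
        has_derivative (\<lambda>u. p_of u + h *\<^sub>R (\<Sum>s\<in>J. Ah (fst r) (fst s) $$ (snd r, snd s) *\<^sub>R K u s))) (at y)"
        by (intro has_derivative_add p_of_has_derivative has_derivative_ident has_derivative_scaleR_right has_derivative_sum K)
    next
      fix z assume "z \<in> U"
      then show "P (fst r) (snd r) z = p_of z + h *\<^sub>R (\<Sum>s\<in>J. Ah (fst r) (fst s) $$ (snd r, snd s) *\<^sub>R - grad (V (fst s)) (Q (fst s) (snd s) z))"
        using r stages unfolding pgark_stages_def sumJ by (auto simp: I_def)
    qed
    then show ?thesis by simp
  qed
  have DQ_eq: "DQ r u = q_of u + h *\<^sub>R (\<Sum>s\<in>I. A (fst r) (fst s) $$ (snd r, snd s) *\<^sub>R L u s)" if r: "r \<in> J" for r u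
  proof -
    have "DQ r = (\<lambda>u. q_of u + h *\<^sub>R (\<Sum>s\<in>I. A (fst r) (fst s) $$ (snd r, snd s) *\<^sub>R L u s))"
    proof (rule has_derivative_unique_on_open[OF DQ[OF r] _ U y])
      show "((\<lambda>z. q_of z + h *\<^sub>R (\<Sum>s\<in>I. A (fst r) (fst s) $$ (snd r, snd s) *\<^sub>R grad (T (fst s)) (P (fst s) (snd s) z)))
        has_derivative (\<lambda>u. q_of u + h *\<^sub>R (\<Sum>s\<in>I. A (fst r) (fst s) $$ (snd r, snd s) *\<^sub>R L u s))) (at y)"
        by (intro has_derivative_add q_of_has_derivative has_derivative_ident has_derivative_scaleR_right has_derivative_sum L)
    next
      fix z assume "z \<in> U"
      then show "Q (fst r) (snd r) z = q_of z + h *\<^sub>R (\<Sum>s\<in>I. A (fst r) (fst s) $$ (snd r, snd s) *\<^sub>R grad (T (fst s)) (P (fst s) (snd s) z))"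
        using r stages unfolding pgark_stages_def sumI by (auto simp: J_def)
    qed
    then show ?thesis by simp
  qed
  have result: "((\<lambda>y. pgark_result N b bh T V h (p_of y) (q_of y) (\<lambda>q i. P q i y) (\<lambda>q i. Q q i y)) has_derivative
      (\<lambda>u. pq (p_of u + h *\<^sub>R (\<Sum>s\<in>J. (bh (fst s) $v snd s) *\<^sub>R K u s))
              (q_of u + h *\<^sub>R (\<Sum>s\<in>I. (b (fst s) $v snd s) *\<^sub>R L u s)))) (at y)"
    unfolding pgark_result_def sumI sumJ
    by (intro pq_has_derivative has_derivative_add p_of_has_derivative q_of_has_derivative has_derivative_ident
        has_derivative_scaleR_right has_derivative_sum K L)
  show "symplectic_at (\<lambda>y. pgark_result N b bh T V h (p_of y) (q_of y) (\<lambda>q i. P q i y) (\<lambda>q i. Q q i y)) y"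
    unfolding symplectic_at_iff[OF result] symp_form_def p_of_pq q_of_pq
  proof (intro allI)
    fix u v
    show "(p_of u + h *\<^sub>R (\<Sum>s\<in>J. (bh (fst s) $v snd s) *\<^sub>R K u s)) \<bullet>
            (q_of v + h *\<^sub>R (\<Sum>s\<in>I. (b (fst s) $v snd s) *\<^sub>R L v s)) -
          (q_of u + h *\<^sub>R (\<Sum>s\<in>I. (b (fst s) $v snd s) *\<^sub>R L u s)) \<bullet>
            (p_of v + h *\<^sub>R (\<Sum>s\<in>J. (bh (fst s) $v snd s) *\<^sub>R K v s)) =
          p_of u \<bullet> q_of v - q_of u \<bullet> p_of v"
    proof (rule two_form_identity)
      show "L u i \<bullet> DP i v = DP i u \<bullet> L v i" if "i \<in> I" for i
        by (simp add: L_def HT(2)[OF that])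
      show "K u j \<bullet> DQ j v = DQ j u \<bullet> K v j" if "j \<in> J" for j
        by (simp add: K_def HV(2)[OF that])
    qed (use M in \<open>auto simp: DP_eq DQ_eq I_def J_def\<close>)
  qed
qed

section \<open>Two forms of the scheme and of its conditions\<close>

text \<open>Multiplying by a diagonal matrix scales rows or columns, so the matrix equation can be
  read entry by entry. Neither pair of arguments is tied to the kinetic or the potential part, so
  the lemma also serves with the two parts exchanged.\<close>

lemma coefficient_condition_iff:
  assumes "X \<in> carrier_mat (dim_vec v) (dim_vec w)" "Y \<in> carrier_mat (dim_vec w) (dim_vec v)"
  shows "transpose_mat X * diag_of v + diag_of w * Y - outer w v = 0\<^sub>m (dim_vec w) (dim_vec v) \<longleftrightarrow>
    (\<forall>i<dim_vec v. \<forall>j<dim_vec w. X $$ (i, j) * v $v i + w $v j * Y $$ (j, i) - w $v j * v $v i = 0)"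
    (is "?M = _ \<longleftrightarrow> _")
proof -
  have XD: "transpose_mat X * diag_of v = Matrix.mat (dim_vec w) (dim_vec v) (\<lambda>(j, i). X $$ (i, j) * v $v i)"
    unfolding diag_of_def using assms by (subst mat_diag_mult_right[of _ "dim_vec w"]) auto
  have DY: "diag_of w * Y = Matrix.mat (dim_vec w) (dim_vec v) (\<lambda>(j, i). w $v j * Y $$ (j, i))"
    unfolding diag_of_def using assms by (subst mat_diag_mult_left[of _ _ "dim_vec v"]) auto
  have O: "outer w v = Matrix.mat (dim_vec w) (dim_vec v) (\<lambda>(j, i). w $v j * v $v i)"
    unfolding outer_def by (rule eq_matI) (auto simp: mat_of_cols_index scalar_prod_def)
  have "?M = Matrix.mat (dim_vec w) (dim_vec v)
      (\<lambda>(j, i). X $$ (i, j) * v $v i + w $v j * Y $$ (j, i) - w $v j * v $v i)"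
    unfolding XD DY O by (rule eq_matI) auto
  then show ?thesis
    by (auto simp: mat_eq_iff)
qed

lemma sum_atLeast1_atMost_double:
  fixes f :: "nat \<Rightarrow> 'a::comm_monoid_add"
  shows "(\<Sum>m=1..2*N. f m) = (\<Sum>m=1..N. f m) + (\<Sum>m=1..N. f (N + m))"
proof -
  have "(\<Sum>m=1..2*N. f m) = (\<Sum>m=1..N. f m) + (\<Sum>m=N+1..N+N. f m)"
    using sum.ub_add_nat[of 1 N f N] by (simp add: mult_2)
  also have "(\<Sum>m=N+1..N+N. f m) = (\<Sum>m=1..N. f (N + m))"
    using sum.shift_bounds_cl_nat_ivl[of f 1 N N] by (simp add: add.commute)
  finally show ?thesis .
qed

lemma sum_kinetic_potential:
  fixes f :: "nat \<Rightarrow> nat \<Rightarrow> 'a::comm_monoid_add"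
  assumes "\<And>m. m \<in> {1..N} \<Longrightarrow> b m = bt m" "\<And>m. m \<in> {1..N} \<Longrightarrow> bh m = bt (N + m)"
  shows "(\<Sum>m=1..2*N. \<Sum>j<dim_vec (bt m). f m j) =
    (\<Sum>m=1..N. \<Sum>j<dim_vec (b m). f m j) + (\<Sum>m=1..N. \<Sum>j<dim_vec (bh m). f (N + m) j)"
  by (subst sum_atLeast1_atMost_double) (simp add: assms cong: sum.cong_simp)

lemma hamiltonian_splitting_simps:
  "m \<in> {1..N} \<Longrightarrow> hamiltonian_splitting N T V m y = pq 0 (grad (T m) (p_of y))"
  "m \<in> {1..N} \<Longrightarrow> hamiltonian_splitting N T V (N + m) y = pq (- grad (V m) (q_of y)) 0"
  by (auto simp: hamiltonian_splitting_def)

section \<open>Equivalence of the 2N-way scheme and the partitioned scheme\<close>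

context
  fixes N :: nat and At A Ah :: "nat \<Rightarrow> nat \<Rightarrow> real mat" and bt b bh :: "nat \<Rightarrow> real Matrix.vec"
  assumes Ah: "\<And>l m. l \<in> {1..N} \<Longrightarrow> m \<in> {1..N} \<Longrightarrow> Ah l m = At l (N + m)"
    and A: "\<And>l m. l \<in> {1..N} \<Longrightarrow> m \<in> {1..N} \<Longrightarrow> A l m = At (N + l) m"
    and bh: "\<And>m. m \<in> {1..N} \<Longrightarrow> bh m = bt (N + m)"
    and b: "\<And>m. m \<in> {1..N} \<Longrightarrow> b m = bt m"
begin

text \<open>Kinetic fields move only \<open>q\<close> and read only \<open>p\<close>, potential
  fields the reverse, so the sum separates into a pair. The weights \<open>c\<close> are left open
  to cover both the rows of \<open>At\<close> and the final weights \<open>bt\<close>.\<close>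

lemma gark_sum_split:
  fixes T V :: "nat \<Rightarrow> real ^ 'd::finite \<Rightarrow> real"
  shows "(\<Sum>m=1..2*N. \<Sum>j<dim_vec (bt m). c m j *\<^sub>R hamiltonian_splitting N T V m (Y m j)) =
    pq (\<Sum>m=1..N. \<Sum>j<dim_vec (bh m). c (N + m) j *\<^sub>R (- grad (V m) (q_of (Y (N + m) j))))
       (\<Sum>m=1..N. \<Sum>j<dim_vec (b m). c m j *\<^sub>R grad (T m) (p_of (Y m j)))"
proof -
  have "(\<Sum>m=1..2*N. \<Sum>j<dim_vec (bt m). c m j *\<^sub>R hamiltonian_splitting N T V m (Y m j)) =
      (\<Sum>m=1..N. \<Sum>j<dim_vec (b m). c m j *\<^sub>R hamiltonian_splitting N T V m (Y m j))
      + (\<Sum>m=1..N. \<Sum>j<dim_vec (bh m). c (N + m) j *\<^sub>R hamiltonian_splitting N T V (N + m) (Y (N + m) j))"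
    by (rule sum_kinetic_potential) (fact b bh)+
  also have "\<dots> = (\<Sum>m=1..N. \<Sum>j<dim_vec (b m). c m j *\<^sub>R pq 0 (grad (T m) (p_of (Y m j))))
      + (\<Sum>m=1..N. \<Sum>j<dim_vec (bh m). c (N + m) j *\<^sub>R pq (- grad (V m) (q_of (Y (N + m) j))) 0)"
    by (intro arg_cong2[of _ _ _ _ "(+)"] sum.cong refl) (auto simp: hamiltonian_splitting_simps)
  also have "\<dots> = pq (\<Sum>m=1..N. \<Sum>j<dim_vec (bh m). c (N + m) j *\<^sub>R (- grad (V m) (q_of (Y (N + m) j))))
       (\<Sum>m=1..N. \<Sum>j<dim_vec (b m). c m j *\<^sub>R grad (T m) (p_of (Y m j)))"
    by (simp add: scaleR_pq sum_pq add_pq)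
  finally show ?thesis .
qed

lemma gark_result_eq_pgark_result:
  "gark_result (2*N) bt (hamiltonian_splitting N T V) h y Y =
    pgark_result N b bh T V h (p_of y) (q_of y) (\<lambda>q i. p_of (Y q i)) (\<lambda>q i. q_of (Y (N + q) i))"
  unfolding gark_result_def pgark_result_def gark_sum_split
  by (simp add: scaleR_pq add_pq b bh cong: sum.cong_simp)

lemma pgark_stages_of_gark_stages:
  assumes "gark_stages (2*N) At bt (hamiltonian_splitting N T V) h y Y"
  shows "pgark_stages N A Ah b bh T V h (p_of y) (q_of y) (\<lambda>q i. p_of (Y q i)) (\<lambda>q i. q_of (Y (N + q) i))"
  unfolding pgark_stages_def
proof (intro conjI ballI allI impI)
  fix q i assume q: "q \<in> {1..N}" and i: "i < dim_vec (b q)"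
  then have "Y q i = y + h *\<^sub>R (\<Sum>m=1..2*N. \<Sum>j<dim_vec (bt m). At q m $$ (i, j) *\<^sub>R hamiltonian_splitting N T V m (Y m j))"
    using assms b by (simp add: gark_stages_def)
  then show "p_of (Y q i) = p_of y + h *\<^sub>R (\<Sum>m=1..N. \<Sum>j<dim_vec (bh m). Ah q m $$ (i, j) *\<^sub>R - grad (V m) (q_of (Y (N + m) j)))"
    unfolding gark_sum_split using q by (simp add: Ah cong: sum.cong_simp)
next
  fix q i assume q: "q \<in> {1..N}" and i: "i < dim_vec (bh q)"
  then have "Y (N + q) i = y + h *\<^sub>R (\<Sum>m=1..2*N. \<Sum>j<dim_vec (bt m). At (N + q) m $$ (i, j) *\<^sub>R hamiltonian_splitting N T V m (Y m j))"
    using assms bh by (simp add: gark_stages_def)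
  then show "q_of (Y (N + q) i) = q_of y + h *\<^sub>R (\<Sum>m=1..N. \<Sum>j<dim_vec (b m). A q m $$ (i, j) *\<^sub>R grad (T m) (p_of (Y m j)))"
    unfolding gark_sum_split using q by (simp add: A cong: sum.cong_simp)
qed

text \<open>The components missing from the partitioned stages are computed with the
  blocks of \<open>At\<close> that do not influence the step.\<close>

definition gark_extension ::
    "(nat \<Rightarrow> real ^ 'd::finite \<Rightarrow> real) \<Rightarrow> (nat \<Rightarrow> real ^ 'd \<Rightarrow> real) \<Rightarrow> real \<Rightarrow> real ^ ('d + 'd) \<Rightarrow>
     (nat \<Rightarrow> nat \<Rightarrow> real ^ 'd) \<Rightarrow> (nat \<Rightarrow> nat \<Rightarrow> real ^ 'd) \<Rightarrow> nat \<Rightarrow> nat \<Rightarrow> real ^ ('d + 'd)" where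
  "gark_extension T V h y P Q q i =
    (if q \<le> N
     then pq (P q i) (q_of y + h *\<^sub>R (\<Sum>m=1..N. \<Sum>j<dim_vec (b m). At q m $$ (i, j) *\<^sub>R grad (T m) (P m j)))
     else pq (p_of y + h *\<^sub>R (\<Sum>m=1..N. \<Sum>j<dim_vec (bh m). At q (N + m) $$ (i, j) *\<^sub>R (- grad (V m) (Q m j))))
             (Q (q - N) i))"

text \<open>The slopes read only the components supplied by \<open>P\<close> and \<open>Q\<close>.
  The added components are therefore explicit and bring no further equation to solve.\<close>

lemma gark_stages_extension:
  assumes st: "pgark_stages N A Ah b bh T V h (p_of y) (q_of y) P Q"
  shows "gark_stages (2*N) At bt (hamiltonian_splitting N T V) h y (gark_extension T V h y P Q)"
  unfolding gark_stages_def gark_sum_split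
proof (intro ballI allI impI)
  fix q i assume q: "q \<in> {1..2*N}" and i: "i < dim_vec (bt q)"
  let ?p = "p_of y + h *\<^sub>R (\<Sum>m=1..N. \<Sum>j<dim_vec (bh m). At q (N + m) $$ (i, j) *\<^sub>R (- grad (V m) (Q m j)))"
  let ?q = "q_of y + h *\<^sub>R (\<Sum>m=1..N. \<Sum>j<dim_vec (b m). At q m $$ (i, j) *\<^sub>R grad (T m) (P m j))"
  have "gark_extension T V h y P Q q i = pq ?p ?q"
  proof (cases "q \<le> N")
    case True
    then have "P q i = ?p"
      using st q i b unfolding pgark_stages_def by (simp add: Ah cong: sum.cong_simp)
    then show ?thesis using True by (simp add: gark_extension_def)
  next
    case False
    then have "q - N \<in> {1..N}" "N + (q - N) = q" using q by auto
    then have "Q (q - N) i = ?q"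
      using st i bh[of "q - N"] A[of "q - N"] unfolding pgark_stages_def by (simp cong: sum.cong_simp)
    then show ?thesis using False by (simp add: gark_extension_def)
  qed
  also have "\<dots> = y + h *\<^sub>R pq
      (\<Sum>m=1..N. \<Sum>j<dim_vec (bh m). At q (N + m) $$ (i, j) *\<^sub>R (- grad (V m) (Q m j)))
      (\<Sum>m=1..N. \<Sum>j<dim_vec (b m). At q m $$ (i, j) *\<^sub>R grad (T m) (P m j))"
    by (simp add: scaleR_pq add_pq)
  finally show "gark_extension T V h y P Q q i = y + h *\<^sub>R pq
      (\<Sum>m=1..N. \<Sum>j<dim_vec (bh m). At q (N + m) $$ (i, j) *\<^sub>R (- grad (V m) (q_of (gark_extension T V h y P Q (N + m) j))))
      (\<Sum>m=1..N. \<Sum>j<dim_vec (b m). At q m $$ (i, j) *\<^sub>R grad (T m) (p_of (gark_extension T V h y P Q m j)))"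
    by (simp add: gark_extension_def cong: sum.cong_simp)
qed

text \<open>Solution branches are transferred in both directions without changing the step: by
  \<open>gark_extension\<close> one way, by projecting the stages to the relevant components the
  other way. The added components stay differentiable because the gradients of smooth functions are
  differentiable.\<close>

lemma gark_symplectic_iff_pgark_symplectic:
  "gark_symplectic TYPE('d::finite) N At bt \<longleftrightarrow> pgark_symplectic TYPE('d) N A Ah b bh"
proof
  assume gark: "gark_symplectic TYPE('d) N At bt"
  show "pgark_symplectic TYPE('d) N A Ah b bh"
    unfolding pgark_symplectic_def
  proof (intro allI impI)
    fix T V :: "nat \<Rightarrow> real ^ 'd \<Rightarrow> real" and h :: real and U :: "(real ^ ('d + 'd)) set"
      and P Q :: "nat \<Rightarrow> nat \<Rightarrow> real ^ ('d + 'd) \<Rightarrow> real ^ 'd"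
    assume smooth: "\<forall>m\<in>{1..N}. smooth (T m) \<and> smooth (V m)" and U: "open U"
      and P: "\<forall>q\<in>{1..N}. \<forall>i<dim_vec (b q). P q i differentiable_on U"
      and Q: "\<forall>q\<in>{1..N}. \<forall>i<dim_vec (bh q). Q q i differentiable_on U"
      and st: "\<forall>y\<in>U. pgark_stages N A Ah b bh T V h (p_of y) (q_of y) (\<lambda>q i. P q i y) (\<lambda>q i. Q q i y)"
    define Y where "Y q i y = gark_extension T V h y (\<lambda>q i. P q i y) (\<lambda>q i. Q q i y) q i" for q i y
    have comp: "(\<lambda>y. grad F (f y)) differentiable (at y)"
      if "smooth F" "f differentiable (at y)" for F and f :: "real ^ ('d + 'd) \<Rightarrow> real ^ 'd" and y
      using that smooth_grad_has_symmetric_derivative[OF that(1)] has_derivative_compose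
      unfolding differentiable_def by blast
    have p: "p_of differentiable F" and q: "q_of differentiable F" for F :: "(real ^ ('d + 'd)) filter"
      using bounded_linear_p_of bounded_linear_q_of bounded_linear_imp_differentiable by auto
    have pq: "(\<lambda>y. pq (f y) (g y)) differentiable (at y)"
      if "f differentiable (at y)" "g differentiable (at y)" for f g :: "real ^ ('d + 'd) \<Rightarrow> real ^ 'd" and y
      using that pq_has_derivative unfolding differentiable_def by blast
    have "Y q i differentiable_on U" if "q \<in> {1..2*N}" "i < dim_vec (bt q)" for q i
    proof -
      have "Y q i differentiable (at y)" if y: "y \<in> U" for y
      proof (cases "q \<le> N")
        case True
        then have "Y q i = (\<lambda>y. pq (P q i y) (q_of y + h *\<^sub>R (\<Sum>m=1..N. \<Sum>j<dim_vec (b m). At q m $$ (i, j) *\<^sub>R grad (T m) (P m j y))))"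
          by (simp add: Y_def gark_extension_def fun_eq_iff)
        then show ?thesis
          using P smooth \<open>q \<in> _\<close> \<open>i < _\<close> b True y U p q
          by (auto intro!: pq differentiable_add differentiable_scaleR differentiable_sum comp
              simp: differentiable_on_eq_differentiable_at)
      next
        case False
        then have "Y q i = (\<lambda>y. pq (p_of y + h *\<^sub>R (\<Sum>m=1..N. \<Sum>j<dim_vec (bh m). At q (N + m) $$ (i, j) *\<^sub>R (- grad (V m) (Q m j y)))) (Q (q - N) i y))"
          by (simp add: Y_def gark_extension_def fun_eq_iff)
        moreover have "q - N \<in> {1..N}" using False \<open>q \<in> _\<close> by auto
        moreover from this have "i < dim_vec (bh (q - N))"
          using False \<open>i < _\<close> bh[of "q - N"] by simp
        ultimately show ?thesis
          using Q smooth y U p q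
          by (auto intro!: pq differentiable_add differentiable_minus differentiable_scaleR differentiable_sum comp
              simp: differentiable_on_eq_differentiable_at)
      qed
      then show ?thesis using U by (simp add: differentiable_on_eq_differentiable_at)
    qed
    moreover have "gark_stages (2*N) At bt (hamiltonian_splitting N T V) h y (\<lambda>q i. Y q i y)" if "y \<in> U" for y
      unfolding Y_def using st that by (intro gark_stages_extension) blast
    ultimately have *: "\<forall>y\<in>U. symplectic_at
        (\<lambda>y. gark_result (2*N) bt (hamiltonian_splitting N T V) h y (\<lambda>q i. Y q i y)) y"
      using gark smooth U unfolding gark_symplectic_def by blast
    have "gark_result (2*N) bt (hamiltonian_splitting N T V) h y (\<lambda>q i. Y q i y) =
        pgark_result N b bh T V h (p_of y) (q_of y) (\<lambda>q i. P q i y) (\<lambda>q i. Q q i y)" for y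
      unfolding gark_result_eq_pgark_result
      by (simp add: pgark_result_def Y_def gark_extension_def cong: sum.cong_simp)
    with * show "\<forall>y\<in>U. symplectic_at
        (\<lambda>y. pgark_result N b bh T V h (p_of y) (q_of y) (\<lambda>q i. P q i y) (\<lambda>q i. Q q i y)) y"
      by simp
  qed
next
  assume pgark: "pgark_symplectic TYPE('d) N A Ah b bh"
  show "gark_symplectic TYPE('d) N At bt"
    unfolding gark_symplectic_def
  proof (intro allI impI)
    fix T V :: "nat \<Rightarrow> real ^ 'd \<Rightarrow> real" and h :: real and U :: "(real ^ ('d + 'd)) set"
      and Y :: "nat \<Rightarrow> nat \<Rightarrow> real ^ ('d + 'd) \<Rightarrow> real ^ ('d + 'd)"
    assume smooth: "\<forall>m\<in>{1..N}. smooth (T m) \<and> smooth (V m)" and U: "open U"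
      and Y: "\<forall>q\<in>{1..2*N}. \<forall>i<dim_vec (bt q). Y q i differentiable_on U"
      and st: "\<forall>y\<in>U. gark_stages (2*N) At bt (hamiltonian_splitting N T V) h y (\<lambda>q i. Y q i y)"
    have "(\<lambda>y. p_of (Y q i y)) differentiable_on U" if "q \<in> {1..N}" "i < dim_vec (b q)" for q i
    proof -
      have "Y q i differentiable_on U" using Y that b[of q] by auto
      then show ?thesis
        using p_of_has_derivative unfolding differentiable_on_def differentiable_def by blast
    qed
    moreover have "(\<lambda>y. q_of (Y (N + q) i y)) differentiable_on U" if "q \<in> {1..N}" "i < dim_vec (bh q)" for q i
    proof -
      have "Y (N + q) i differentiable_on U" using Y that bh[of q] by auto
      then show ?thesis
        using q_of_has_derivative unfolding differentiable_on_def differentiable_def by blast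
    qed
    moreover have "\<forall>y\<in>U. pgark_stages N A Ah b bh T V h (p_of y) (q_of y) (\<lambda>q i. p_of (Y q i y)) (\<lambda>q i. q_of (Y (N + q) i y))"
      using st pgark_stages_of_gark_stages by blast
    ultimately have "\<forall>y\<in>U. symplectic_at (\<lambda>y. pgark_result N b bh T V h (p_of y) (q_of y)
        (\<lambda>q i. p_of (Y q i y)) (\<lambda>q i. q_of (Y (N + q) i y))) y"
      using pgark[unfolded pgark_symplectic_def, rule_format, of T V U
        "\<lambda>q i y. p_of (Y q i y)" "\<lambda>q i y. q_of (Y (N + q) i y)" h] smooth U
      by blast
    then show "\<forall>y\<in>U. symplectic_at
        (\<lambda>y. gark_result (2*N) bt (hamiltonian_splitting N T V) h y (\<lambda>q i. Y q i y)) y"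
      by (simp add: gark_result_eq_pgark_result)
  qed
qed

end

section \<open>Smooth functions with locally affine derivatives\<close>

text \<open>Everywhere \<open>k\<close> times differentiable functions of one variable. The
  derivative is existentially quantified, so the closure rules follow by induction from the calculus
  rules. Continuity of the \<open>k\<close>-th derivative is obtained from level
  \<open>Suc k\<close>.\<close>

fun D_k :: "nat \<Rightarrow> (real \<Rightarrow> real) \<Rightarrow> bool" where
  "D_k 0 f \<longleftrightarrow> True"
| "D_k (Suc k) f \<longleftrightarrow> (\<exists>f'. (\<forall>x. (f has_real_derivative f' x) (at x)) \<and> D_k k f')"

lemma D_k_Suc_D: "D_k (Suc k) f \<Longrightarrow> D_k k f"
proof (induction k arbitrary: f)
  case (Suc k)
  then obtain f' where f': "\<forall>x. (f has_real_derivative f' x) (at x)" "D_k (Suc k) f'"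
    by auto
  then have "D_k k f'" using Suc.IH by blast
  with f' show ?case by auto
qed simp

lemma D_k_const: "D_k k (\<lambda>x. c)"
proof (induction k arbitrary: c)
  case (Suc k)
  then show ?case by (auto intro!: exI[of _ "\<lambda>_. 0"] derivative_eq_intros)
qed simp

lemma D_k_ident: "D_k k (\<lambda>x. x)"
  by (cases k) (auto intro!: exI[of _ "\<lambda>_. 1"] derivative_eq_intros D_k_const)

lemma D_k_add: "D_k k f \<Longrightarrow> D_k k g \<Longrightarrow> D_k k (\<lambda>x. f x + g x)"
proof (induction k arbitrary: f g)
  case (Suc k)
  then obtain f' g' where
    "\<forall>x. (f has_real_derivative f' x) (at x)" "D_k k f'"
    "\<forall>x. (g has_real_derivative g' x) (at x)" "D_k k g'"
    by auto
  then show ?case using Suc.IH[of f' g']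
    by (auto intro!: exI[of _ "\<lambda>x. f' x + g' x"] derivative_eq_intros)
qed simp

lemma D_k_mult: "D_k k f \<Longrightarrow> D_k k g \<Longrightarrow> D_k k (\<lambda>x. f x * g x)"
proof (induction k arbitrary: f g)
  case (Suc k)
  then obtain f' g' where d:
    "\<forall>x. (f has_real_derivative f' x) (at x)" "D_k k f'"
    "\<forall>x. (g has_real_derivative g' x) (at x)" "D_k k g'"
    by auto
  have "D_k k (\<lambda>x. f' x * g x + f x * g' x)"
    using Suc.IH Suc.prems d D_k_Suc_D by (intro D_k_add) blast+
  moreover have "((\<lambda>x. f x * g x) has_real_derivative f' x * g x + f x * g' x) (at x)" for x
    using d by (auto intro!: derivative_eq_intros)
  ultimately show ?case by (auto intro!: exI[of _ "\<lambda>x. f' x * g x + f x * g' x"])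
qed simp

lemma D_k_sum: "(\<And>i. i \<in> I \<Longrightarrow> D_k k (f i)) \<Longrightarrow> D_k k (\<lambda>x. \<Sum>i\<in>I. f i x)"
  by (induction I rule: infinite_finite_induct) (auto intro: D_k_const D_k_add)

lemma D_k_inverse: "D_k k f \<Longrightarrow> (\<And>x. f x \<noteq> 0) \<Longrightarrow> D_k k (\<lambda>x. inverse (f x))"
proof (induction k arbitrary: f)
  case (Suc k)
  then obtain f' where d: "\<forall>x. (f has_real_derivative f' x) (at x)" "D_k k f'"
    by auto
  have "D_k k (\<lambda>x. (- 1) * (f' x * (inverse (f x) * inverse (f x))))"
    using Suc d D_k_Suc_D by (intro D_k_mult D_k_const) blast+
  moreover have "((\<lambda>x. inverse (f x)) has_real_derivative
      (- 1) * (f' x * (inverse (f x) * inverse (f x)))) (at x)" for x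
    using d Suc.prems(2) by (auto intro!: derivative_eq_intros)
  ultimately show ?case by (auto intro!: exI[of _ "\<lambda>x. (- 1) * (f' x * (inverse (f x) * inverse (f x)))"])
qed simp

lemma D_k_affine: "D_k k f \<Longrightarrow> D_k k (\<lambda>x. f (a * x + b))"
proof (induction k arbitrary: f)
  case (Suc k)
  then obtain f' where d: "\<forall>x. (f has_real_derivative f' x) (at x)" "D_k k f'"
    by auto
  have "D_k k (\<lambda>x. f' (a * x + b) * a)"
    using Suc.IH[OF d(2)] by (intro D_k_mult D_k_const)
  moreover have "((\<lambda>x. f (a * x + b)) has_real_derivative f' (a * x + b) * a) (at x)" for x
    using d(1) by (auto intro!: derivative_eq_intros DERIV_chain2[of f])
  ultimately show ?case by (auto intro!: exI[of _ "\<lambda>x. f' (a * x + b) * a"])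
qed simp

section \<open>A smooth cutoff function\<close>

text \<open>The standard function that is flat at 0, with a polynomial factor in
  \<open>1 / x\<close>. The factor makes the family closed under differentiation.\<close>

definition exp_ramp :: "real poly \<Rightarrow> real \<Rightarrow> real" where
  "exp_ramp p x = (if 0 < x then poly p (1 / x) * exp (- (1 / x)) else 0)"

lemma poly_exp_tendsto_0: "((\<lambda>t::real. poly p t * exp (- t)) \<longlongrightarrow> 0) at_top"
proof -
  have "((\<lambda>t. \<Sum>i\<le>degree p. coeff p i * (t ^ i / exp t)) \<longlongrightarrow> (\<Sum>i\<le>degree p. coeff p i * 0)) at_top"
    by (intro tendsto_intros tendsto_power_div_exp_0)
  then show ?thesis
    by (simp add: poly_altdef sum_distrib_right exp_minus divide_inverse mult.assoc)
qed

text \<open>With \<open>t = 1 / x\<close> the chain rule contributes the factor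
  \<open>- (t * t)\<close>, hence \<open>[:0, 0, 1:]\<close>. At 0 the difference quotient tends to
  0 because the exponential beats every polynomial.\<close>

lemma exp_ramp_has_derivative:
  "(exp_ramp p has_real_derivative exp_ramp ([:0, 0, 1:] * (p - pderiv p)) x) (at x)"
proof -
  consider "x < 0" | "x = 0" | "x > 0" by linarith
  then show ?thesis
  proof cases
    case 1
    have "(exp_ramp p has_real_derivative 0) (at x)"
      by (rule has_field_derivative_transform_within_open[of "\<lambda>_. 0" _ _ "{..<0}"])
        (use 1 in \<open>auto simp: exp_ramp_def\<close>)
    then show ?thesis using 1 by (simp add: exp_ramp_def)
  next
    case 3
    have "((\<lambda>x. poly p (1 / x) * exp (- (1 / x))) has_real_derivative
        poly ([:0, 0, 1:] * (p - pderiv p)) (1 / x) * exp (- (1 / x))) (at x)"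
      using 3 by (auto intro!: derivative_eq_intros DERIV_chain2[OF poly_DERIV]
        simp: field_simps power2_eq_square)
    then have "(exp_ramp p has_real_derivative
        poly ([:0, 0, 1:] * (p - pderiv p)) (1 / x) * exp (- (1 / x))) (at x)"
      by (rule has_field_derivative_transform_within_open[of _ _ _ "{0<..}"])
        (use 3 in \<open>auto simp: exp_ramp_def\<close>)
    then show ?thesis using 3 by (simp add: exp_ramp_def)
  next
    case 2
    have "((\<lambda>h. exp_ramp p h / h) \<longlongrightarrow> 0) (at_right 0)"
    proof -
      \<comment> \<open>\<open>pCons 0 p\<close> multiplies by \<open>t = 1 / h\<close>, which is
        the division by \<open>h\<close> in the difference quotient.\<close>
      have "((\<lambda>h. poly (pCons 0 p) (inverse h) * exp (- inverse h)) \<longlongrightarrow> 0) (at_right (0::real))"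
        by (rule filterlim_compose[OF poly_exp_tendsto_0 filterlim_inverse_at_top_right])
      then show ?thesis
        by (rule Lim_transform_eventually)
          (auto simp: eventually_at_right_field exp_ramp_def field_simps intro!: exI[of _ 1])
    qed
    moreover have "((\<lambda>h. exp_ramp p h / h) \<longlongrightarrow> 0) (at_left 0)"
      by (rule Lim_transform_eventually[OF tendsto_const])
        (auto simp: eventually_at_left_field exp_ramp_def intro!: exI[of _ "-1"])
    ultimately have "((\<lambda>h. exp_ramp p h / h) \<longlongrightarrow> 0) (at 0)"
      by (rule filterlim_split_at[rotated])
    then show ?thesis using 2 by (simp add: exp_ramp_def DERIV_def)
  qed
qed

lemma D_k_exp_ramp: "D_k k (exp_ramp p)"
  by (induction k arbitrary: p) (use exp_ramp_has_derivative in auto)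

lemma smooth_bump_exists:
  "\<exists>\<beta>. (\<forall>k. D_k k \<beta>) \<and> (\<forall>x. \<bar>x\<bar> < 1 \<longrightarrow> \<beta> x = 1) \<and> (\<forall>x. 2 < \<bar>x\<bar> \<longrightarrow> \<beta> x = 0)"
proof -
  let ?e = "exp_ramp 1"
  have nonneg: "0 \<le> ?e x" for x by (simp add: exp_ramp_def)
  have pos: "0 < x \<Longrightarrow> 0 < ?e x" for x by (simp add: exp_ramp_def)
  have zero: "x \<le> 0 \<Longrightarrow> ?e x = 0" for x by (simp add: exp_ramp_def)
  \<comment> \<open>A smooth transition from 0 on \<open>x \<le> 0\<close> to 1 on
    \<open>x \<ge> 1\<close>; the denominator is positive since \<open>x\<close> or
    \<open>1 - x\<close> is. Arguments are written in the form \<open>a * x + b\<close> to match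
    \<open>D_k_affine\<close>.\<close>
  define step where "step x = ?e x * inverse (?e x + ?e (- 1 * x + 1))" for x
  have "?e x + ?e (- 1 * x + 1) > 0" for x
    using nonneg[of x] nonneg[of "-x+1"] pos[of x] pos[of "-x+1"] by (cases "x > 0") auto
  then have nz: "?e x + ?e (- 1 * x + 1) \<noteq> 0" for x by (metis less_irrefl)
  have step: "D_k k step" for k
    unfolding step_def
    by (intro D_k_mult D_k_inverse D_k_add D_k_affine D_k_exp_ramp nz)
  have step1: "step x = 1" if "x \<ge> 1" for x
    using that pos[of x] zero[of "-x+1"] by (simp add: step_def)
  have step0: "step x = 0" if "x \<le> 0" for x
    using that zero[of x] by (simp add: step_def)
  show ?thesis
  \<comment> \<open>A rising step, completed at -1, times a falling one that starts at 1.\<close>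
  proof (intro exI[of _ "\<lambda>x. step (1 * x + 2) * step (-1 * x + 2)"] conjI allI impI)
    show "D_k k (\<lambda>x. step (1 * x + 2) * step (- 1 * x + 2))" for k
      by (intro D_k_mult D_k_affine step)
  qed (auto simp: step1 abs_if step0 split: if_splits)
qed

text \<open>Around each point a quadratic with the wanted affine derivative is cut off by a scaled
  bump. Near one point the bumps of all others vanish and its own bump is 1.\<close>

lemma smooth_locally_affine_derivative:
  fixes c \<sigma> :: "real \<Rightarrow> real"
  assumes "finite X"
  shows "\<exists>\<phi> \<phi>' \<epsilon>. (\<forall>k. D_k k \<phi>) \<and> (\<forall>t. (\<phi> has_real_derivative \<phi>' t) (at t)) \<and> 0 < \<epsilon> \<and>
    (\<forall>x\<in>X. \<forall>t. \<bar>t - x\<bar> < \<epsilon> \<longrightarrow> \<phi>' t = c x + \<sigma> x * (t - x))"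
proof -
  obtain \<beta> where \<beta>: "\<And>k. D_k k \<beta>" "\<And>x. \<bar>x\<bar> < 1 \<Longrightarrow> \<beta> x = 1" "\<And>x. 2 < \<bar>x\<bar> \<Longrightarrow> \<beta> x = 0"
    using smooth_bump_exists by auto
  obtain d where d: "0 < d" "\<And>x y. x \<in> X \<Longrightarrow> y \<in> X \<Longrightarrow> x \<noteq> y \<Longrightarrow> d \<le> \<bar>y - x\<bar>"
  proof (cases "X = {}")
    case False
    have "\<forall>x\<in>X. \<exists>e>0. \<forall>y\<in>X. y \<noteq> x \<longrightarrow> e \<le> dist x y"
      using finite_set_avoid[OF assms] by blast
    then obtain e where e: "\<And>x. x \<in> X \<Longrightarrow> 0 < e x \<and> (\<forall>y\<in>X. y \<noteq> x \<longrightarrow> e x \<le> dist x y)"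
      by metis
    show ?thesis
    proof (rule that[of "Min (e ` X)"])
      show "0 < Min (e ` X)" using e assms False by auto
      fix x y assume xy: "x \<in> X" "y \<in> X" "x \<noteq> y"
      then have "Min (e ` X) \<le> e x" using assms by simp
      also have "e x \<le> \<bar>y - x\<bar>" using e xy by (auto simp: dist_real_def abs_minus_commute)
      finally show "Min (e ` X) \<le> \<bar>y - x\<bar>" .
    qed
  qed (use that[of 1] in auto)
  \<comment> \<open>The bump at \<open>y\<close> vanishes beyond \<open>2 * \<epsilon>\<close>,
    while points within \<open>\<epsilon>\<close> of another node are more than
    \<open>3 * \<epsilon>\<close> away from \<open>y\<close>.\<close>
  define \<epsilon> where "\<epsilon> = d / 4"
  have \<epsilon>: "0 < \<epsilon>" using d by (simp add: \<epsilon>_def)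
  define \<phi> where "\<phi> t = (\<Sum>x\<in>X. \<beta> (1/\<epsilon> * t + - x/\<epsilon>) *
      ((t + - x) * (c x + \<sigma> x / 2 * (t + - x))))" for t
  have D: "D_k k \<phi>" for k
    unfolding \<phi>_def
    by (intro D_k_sum D_k_mult D_k_add D_k_affine[of _ \<beta>] \<beta> D_k_const D_k_ident)
  \<comment> \<open>No global formula for the derivative is computed: some derivative exists, and
    uniqueness identifies it near the nodes.\<close>
  have "D_k (Suc 0) \<phi>" by (rule D)
  then obtain \<phi>' where \<phi>': "\<And>t. (\<phi> has_real_derivative \<phi>' t) (at t)" by auto
  have "\<phi>' t = c x + \<sigma> x * (t - x)" if x: "x \<in> X" and t: "\<bar>t - x\<bar> < \<epsilon>" for x t
  proof -
    have eq: "(u - x) * (c x + \<sigma> x / 2 * (u - x)) = \<phi> u" if u: "\<bar>u - x\<bar> < \<epsilon>" for u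
    proof -
      have arg: "1/\<epsilon> * u + - y/\<epsilon> = (u - y) / \<epsilon>" for y by (simp add: diff_divide_distrib)
      have "\<beta> (1/\<epsilon> * u + - y/\<epsilon>) = (if y = x then 1 else 0)" if "y \<in> X" for y
      proof (cases "y = x")
        case True
        then show ?thesis unfolding arg using u \<epsilon> by (simp add: \<beta>(2))
      next
        case False
        then have "4 * \<epsilon> \<le> \<bar>y - x\<bar>" using d(2)[of x y] x that by (simp add: \<epsilon>_def)
        then have "2 * \<epsilon> < \<bar>u - y\<bar>" using u \<epsilon> by linarith
        then show ?thesis unfolding arg using False \<epsilon> by (simp add: \<beta>(3) pos_less_divide_eq)
      qed
      then have "\<phi> u = (\<Sum>y\<in>X. if y = x then (u - x) * (c x + \<sigma> x / 2 * (u - x)) else 0)"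
        unfolding \<phi>_def by (intro sum.cong) auto
      then show ?thesis using x assms by simp
    qed
    have "((\<lambda>u. (u - x) * (c x + \<sigma> x / 2 * (u - x))) has_real_derivative c x + \<sigma> x * (t - x)) (at t)"
      by (auto intro!: derivative_eq_intros simp: field_simps)
    then have "(\<phi> has_real_derivative c x + \<sigma> x * (t - x)) (at t)"
      by (rule has_field_derivative_transform_within_open[of _ _ _ "ball x \<epsilon>"])
        (use t eq in \<open>auto simp: dist_real_def abs_minus_commute\<close>)
    then show ?thesis using \<phi>' DERIV_unique by blast
  qed
  with D \<phi>' \<epsilon> show ?thesis by blast
qed

section \<open>Functions of a single coordinate\<close>

lemma partial_component:
  assumes "\<And>t. (\<phi> has_real_derivative \<phi>' t) (at t)"
  shows "(\<lambda>x::real^'d::finite. \<phi> (x $ a)) differentiable (at x)"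
    and "partial b (\<lambda>x::real^'d. \<phi> (x $ a)) x = (if b = a then \<phi>' (x $ a) else 0)"
proof -
  have d: "((\<lambda>x::real^'d. \<phi> (x $ a)) has_derivative (\<lambda>v. v $ a * \<phi>' (x $ a))) (at x)"
    using has_derivative_compose[OF bounded_linear_imp_has_derivative[OF bounded_linear_vec_nth]
      assms[unfolded has_field_derivative_def]]
    by (simp add: mult.commute)
  then show "(\<lambda>x::real^'d. \<phi> (x $ a)) differentiable (at x)"
    by (auto simp: differentiable_def)
  show "partial b (\<lambda>x::real^'d. \<phi> (x $ a)) x = (if b = a then \<phi>' (x $ a) else 0)"
    unfolding partial_def frechet_derivative_at[OF d, symmetric] by (simp add: axis_def)
qed

lemma grad_component:
  assumes "\<And>t. (\<phi> has_real_derivative \<phi>' t) (at t)"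
  shows "grad (\<lambda>x::real^'d::finite. \<phi> (x $ a)) x = axis a (\<phi>' (x $ a))"
  by (simp add: grad_def partial_component[OF assms] axis_def vec_eq_iff)

text \<open>Partial derivatives are again functions of the coordinate \<open>a\<close>, namely of
  \<open>\<phi>'\<close> or of the zero function, so induction applies. The extra level of
  \<open>D_k\<close> pays for continuity at the end.\<close>

lemma C_k_component: "D_k (Suc k) \<phi> \<Longrightarrow> C_k k (\<lambda>x::real^'d::finite. \<phi> (x $ a))"
proof (induction k arbitrary: \<phi>)
  case 0
  then have "continuous_on UNIV \<phi>"
    by (meson D_k.simps(2) DERIV_isCont continuous_at_imp_continuous_on)
  then have "continuous_on UNIV (\<lambda>x::real^'d. \<phi> (x $ a))"
    by (rule continuous_on_compose2) (auto intro!: continuous_intros)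
  then show ?case by simp
next
  case (Suc k)
  from Suc.prems obtain \<phi>' where \<phi>': "\<And>t. (\<phi> has_real_derivative \<phi>' t) (at t)" "D_k (Suc k) \<phi>'"
    by (subst (asm) D_k.simps) blast
  have "C_k k (partial b (\<lambda>x::real^'d. \<phi> (x $ a)))" for b
  proof -
    have "partial b (\<lambda>x::real^'d. \<phi> (x $ a)) = (\<lambda>x. (if b = a then \<phi>' else (\<lambda>_. 0)) (x $ a))"
      by (auto simp: partial_component[OF \<phi>'(1)])
    then show ?thesis
      using Suc.IH[of "if b = a then \<phi>' else (\<lambda>_. 0)"] \<phi>'(2) D_k_const by (auto simp del: D_k.simps)
  qed
  then show ?case using partial_component(1)[OF \<phi>'(1)] by auto
qed

lemma smooth_component: "(\<And>k. D_k k \<phi>) \<Longrightarrow> smooth (\<lambda>x::real^'d::finite. \<phi> (x $ a))"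
  by (simp add: smooth_def C_k_component)

section \<open>Necessity\<close>

lemma pgark_reduction_swap:
  "pgark_reduction N A Ah b bh R S \<longleftrightarrow> pgark_reduction N Ah A bh b S R"
  unfolding pgark_reduction_def by blast

text \<open>The kinetic and potential parts enter symmetrically, so facts about the stages of one
  part carry over to the other.\<close>

lemma pgark_irreducible_swap:
  "pgark_irreducible N A Ah b bh \<Longrightarrow> pgark_irreducible N Ah A bh b"
  unfolding pgark_irreducible_def by (subst (asm) pgark_reduction_swap) blast

text \<open>Stages with equal rows could be merged: identifying only \<open>i\<close> and
  \<open>i'\<close> would be a nontrivial reduction. The condition on \<open>A\<close> is then
  trivial, because \<open>S\<close> relates each stage only to itself.\<close>

lemma pgark_irreducible_rows_distinct:
  assumes irr: "pgark_irreducible N A Ah b bh"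
    and q: "q \<in> {1..N}" and i: "i < dim_vec (b q)" "i' < dim_vec (b q)" "i \<noteq> i'"
  shows "\<exists>m\<in>{1..N}. \<exists>j<dim_vec (bh m). Ah q m $$ (i, j) \<noteq> Ah q m $$ (i', j)"
proof (rule ccontr)
  assume neg: "\<not> ?thesis"
  define R where "R p = Id_on {..<dim_vec (b p)} \<union> (if p = q then {(i, i'), (i', i)} else {})" for p
  define S where "S p = Id_on {..<dim_vec (bh p)}" for p
  have "equiv {..<dim_vec (b p)} (R p)" for p
    using i by (auto simp: R_def intro!: equivI refl_onI symI transI)
  moreover have S: "equiv {..<dim_vec (bh p)} (S p)" for p
    by (auto simp: S_def intro!: equivI refl_onI symI transI)
  moreover have "(\<Sum>j\<in>C. Ah p m $$ (x, j)) = (\<Sum>j\<in>C. Ah p m $$ (x', j))"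
    if "m \<in> {1..N}" "(x, x') \<in> R p" "C \<in> {..<dim_vec (bh m)} // S m" for p m x x' C
  proof (rule sum.cong[OF refl])
    fix j assume "j \<in> C"
    then have "j < dim_vec (bh m)" using that(3) S[of m] by (auto simp: quotient_def S_def)
    then show "Ah p m $$ (x, j) = Ah p m $$ (x', j)"
      using neg that(1,2) by (auto simp: R_def split: if_splits)
  qed
  ultimately have "pgark_reduction N A Ah b bh R S"
    unfolding pgark_reduction_def by (auto simp: S_def)
  then have "R q = Id_on {..<dim_vec (b q)}"
    using irr q unfolding pgark_irreducible_def by blast
  moreover have "(i, i') \<in> R q" by (simp add: R_def)
  ultimately show False using i by auto
qed

text \<open>Finitely many hyperplanes do not cover the space. A vector avoiding those of
  \<open>F\<close> is moved along a coordinate \<open>j0\<close> with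
  \<open>c j0 \<noteq> 0\<close>; each form excludes only finitely many shifts \<open>t\<close>, so
  some shift avoids all.\<close>

lemma exists_vector_avoiding_hyperplanes:
  fixes F :: "('a \<Rightarrow> real) set"
  assumes "finite F" "finite J" "\<And>c. c \<in> F \<Longrightarrow> \<exists>j\<in>J. c j \<noteq> 0"
  shows "\<exists>k. \<forall>c\<in>F. (\<Sum>j\<in>J. c j * k j) \<noteq> 0"
  using assms(1,3)
proof (induction F rule: finite_induct)
  case (insert c F)
  then obtain k where k: "\<And>c. c \<in> F \<Longrightarrow> (\<Sum>j\<in>J. c j * k j) \<noteq> 0" by auto
  obtain j0 where j0: "j0 \<in> J" "c j0 \<noteq> 0" using insert.prems by auto
  have eq: "(\<Sum>j\<in>J. d j * (k j + (if j = j0 then t else 0))) = (\<Sum>j\<in>J. d j * k j) + d j0 * t" for d t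
    using j0 assms(2) by (simp add: distrib_left sum.distrib if_distrib[of "\<lambda>x. d _ * x"] cong: if_cong)
  have "finite {t. (\<Sum>j\<in>J. d j * k j) + d j0 * t = 0}" if "d \<in> insert c F" for d
  proof (cases "d j0 = 0")
    case True
    then show ?thesis using that j0 k[of d] by (cases "d = c") auto
  next
    case False
    then have "{t. (\<Sum>j\<in>J. d j * k j) + d j0 * t = 0} \<subseteq> {- (\<Sum>j\<in>J. d j * k j) / d j0}"
      by (auto simp: field_simps)
    then show ?thesis using finite_subset by blast
  qed
  then have "finite (\<Union>d\<in>insert c F. {t. (\<Sum>j\<in>J. d j * k j) + d j0 * t = 0})"
    using insert.hyps by blast
  then obtain t where "t \<notin> (\<Union>d\<in>insert c F. {t. (\<Sum>j\<in>J. d j * k j) + d j0 * t = 0})"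
    using ex_new_if_finite[OF infinite_UNIV_char_0] by blast
  then have "\<forall>d\<in>insert c F. (\<Sum>j\<in>J. d j * (k j + (if j = j0 then t else 0))) \<noteq> 0"
    unfolding eq by blast
  then show ?case by (rule exI[of _ "\<lambda>j. k j + (if j = j0 then t else 0)"])
qed auto

text \<open>The hyperplanes to avoid are given by the differences of two coefficient rows of the
  same partition, which are nonzero by irreducibility. The result \<open>k\<close> is a generic
  choice of potential slopes.\<close>

lemma pgark_irreducible_separates_stages:
  assumes irr: "pgark_irreducible N A Ah b bh"
  defines "J \<equiv> Sigma {1..N} (\<lambda>m. {..<dim_vec (bh m)})"
  shows "\<exists>k. \<forall>q\<in>{1..N}. inj_on (\<lambda>i. \<Sum>s\<in>J. Ah q (fst s) $$ (i, snd s) * k s) {..<dim_vec (b q)}"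
proof -
  define D where "D = (SIGMA q:{1..N}. {(i, i'). i < dim_vec (b q) \<and> i' < dim_vec (b q) \<and> i \<noteq> i'})"
  define c where "c d s = Ah (fst d) (fst s) $$ (fst (snd d), snd s) - Ah (fst d) (fst s) $$ (snd (snd d), snd s)"
    for d :: "nat \<times> nat \<times> nat" and s
  have "{(i, i'). i < dim_vec (b q) \<and> i' < dim_vec (b q) \<and> i \<noteq> i'}
      \<subseteq> {..<dim_vec (b q)} \<times> {..<dim_vec (b q)}" for q by auto
  then have "finite {(i, i'). i < dim_vec (b q) \<and> i' < dim_vec (b q) \<and> i \<noteq> i'}" for q
    by (rule finite_subset) auto
  then have "finite D" unfolding D_def by (intro finite_SigmaI) auto
  have "\<exists>s\<in>J. c d s \<noteq> 0" if d: "d \<in> D" for d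
  proof -
    have "\<exists>m\<in>{1..N}. \<exists>j<dim_vec (bh m). Ah (fst d) m $$ (fst (snd d), j) \<noteq> Ah (fst d) m $$ (snd (snd d), j)"
      using d by (intro pgark_irreducible_rows_distinct[OF irr]) (auto simp: D_def)
    then obtain m j where "m \<in> {1..N}" "j < dim_vec (bh m)"
      "Ah (fst d) m $$ (fst (snd d), j) \<noteq> Ah (fst d) m $$ (snd (snd d), j)"
      by blast
    then show ?thesis by (intro bexI[of _ "(m, j)"]) (auto simp: c_def J_def)
  qed
  then have "\<exists>k. \<forall>e\<in>c ` D. (\<Sum>s\<in>J. e s * k s) \<noteq> 0"
    using \<open>finite D\<close> by (intro exists_vector_avoiding_hyperplanes) (auto simp: J_def)
  then obtain k where k: "\<And>d. d \<in> D \<Longrightarrow> (\<Sum>s\<in>J. c d s * k s) \<noteq> 0"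
    by blast
  show ?thesis
  proof (intro exI[of _ k] ballI inj_onI, rule ccontr)
    fix q i i' assume "q \<in> {1..N}" "i \<in> {..<dim_vec (b q)}" "i' \<in> {..<dim_vec (b q)}" "i \<noteq> i'"
      and eq: "(\<Sum>s\<in>J. Ah q (fst s) $$ (i, snd s) * k s) = (\<Sum>s\<in>J. Ah q (fst s) $$ (i', snd s) * k s)"
    then have "(\<Sum>s\<in>J. c (q, i, i') s * k s) \<noteq> 0"
      by (intro k) (auto simp: D_def)
    with eq show False by (simp add: c_def left_diff_distrib sum_subtractf)
  qed
qed

text \<open>Stages of one partition share a potential, so their data can be prescribed independently
  only at distinct positions. Injectivity makes the data a function of position through
  \<open>inv_into\<close>.\<close>

lemma separated_potentials:
  fixes x c \<sigma> :: "nat \<times> 'a \<Rightarrow> real"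
  assumes I: "finite I" and inj: "\<And>q. inj_on x {r \<in> I. fst r = q}"
  shows "\<exists>\<phi> \<phi>' \<epsilon>. (\<forall>q k. D_k k (\<phi> q)) \<and> (\<forall>q t. (\<phi> q has_real_derivative \<phi>' q t) (at t)) \<and> 0 < \<epsilon> \<and>
    (\<forall>r\<in>I. \<forall>t. \<bar>t - x r\<bar> < \<epsilon> \<longrightarrow> \<phi>' (fst r) t = c r + \<sigma> r * (t - x r))"
proof -
  define Z where "Z q = {r \<in> I. fst r = q}" for q
  have inv: "inv_into (Z (fst r)) x (x r) = r" if "r \<in> I" for r
    using that inj by (intro inv_into_f_f) (auto simp: Z_def)
  have "\<exists>\<phi> \<phi>' \<epsilon>. (\<forall>k. D_k k \<phi>) \<and> (\<forall>t. (\<phi> has_real_derivative \<phi>' t) (at t)) \<and> 0 < \<epsilon> \<and>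
    (\<forall>y\<in>x ` Z q. \<forall>t. \<bar>t - y\<bar> < \<epsilon> \<longrightarrow> \<phi>' t = c (inv_into (Z q) x y) + \<sigma> (inv_into (Z q) x y) * (t - y))" for q
    using I by (intro smooth_locally_affine_derivative) (auto simp: Z_def)
  then obtain \<phi> \<phi>' \<epsilon> where *: "\<And>q k. D_k k (\<phi> q)" "\<And>q t. (\<phi> q has_real_derivative \<phi>' q t) (at t)"
    "\<And>q. 0 < \<epsilon> q" "\<And>q y t. y \<in> x ` Z q \<Longrightarrow> \<bar>t - y\<bar> < \<epsilon> q \<Longrightarrow>
      \<phi>' q t = c (inv_into (Z q) x y) + \<sigma> (inv_into (Z q) x y) * (t - y)"
    by metis
  \<comment> \<open>Inserting 1 keeps the minimum defined and positive when there are no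
    stages.\<close>
  define e where "e = Min (insert 1 (\<epsilon> ` fst ` I))"
  have "0 < e" using I *(3) by (simp add: e_def)
  moreover have "\<phi>' (fst r) t = c r + \<sigma> r * (t - x r)" if r: "r \<in> I" and t: "\<bar>t - x r\<bar> < e" for r t
  proof -
    have "e \<le> \<epsilon> (fst r)" using I r by (simp add: e_def)
    then show ?thesis using *(4)[of "x r" "fst r" t] r t inv[OF r] by (auto simp: Z_def)
  qed
  ultimately show ?thesis using *(1,2) by (intro exI[of _ \<phi>] exI[of _ \<phi>'] exI[of _ e]) blast
qed

lemma sum_scaleR_axis: "(\<Sum>s\<in>S. g s *\<^sub>R axis a (f s)) = axis a (\<Sum>s\<in>S. g s * f s :: real)"
  by (simp add: Finite_Cartesian_Product.vec_eq_iff axis_def)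

lemma uminus_axis: "- axis a x = axis a (- x :: real)"
  by (simp add: Finite_Cartesian_Product.vec_eq_iff axis_def)

lemma bounded_linear_axis: "bounded_linear (\<lambda>x::real. axis a x :: real ^ 'd::finite)"
  unfolding linear_conv_bounded_linear[symmetric]
  by (simp add: linear_iff Finite_Cartesian_Product.vec_eq_iff axis_def)

text \<open>Potentials tuned to one pair of stages make the step, with step size 1, affine near 0.
  Its derivative involves only the coefficients of that pair, and symplecticity of this linear map
  is the required equation.\<close>

lemma pgark_symplectic_imp_condition:
  assumes symp: "pgark_symplectic TYPE('d::finite) N A Ah b bh"
    and irr: "pgark_irreducible N A Ah b bh"
    and l0: "l0 \<in> {1..N}" "i0 < dim_vec (b l0)" and m0: "m0 \<in> {1..N}" "j0 < dim_vec (bh m0)"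
  shows "Ah l0 m0 $$ (i0, j0) * b l0 $v i0 + bh m0 $v j0 * A m0 l0 $$ (j0, i0) - bh m0 $v j0 * b l0 $v i0 = 0"
proof -
  define I where "I = Sigma {1..N} (\<lambda>q. {..<dim_vec (b q)})"
  define J where "J = Sigma {1..N} (\<lambda>q. {..<dim_vec (bh q)})"
  have fin: "finite I" "finite J" by (auto simp: I_def J_def)
  have sumI: "(\<Sum>m=1..N. \<Sum>i<dim_vec (b m). f m i) = (\<Sum>r\<in>I. f (fst r) (snd r))"
    for f :: "nat \<Rightarrow> nat \<Rightarrow> real ^ 'd"
    unfolding I_def by (subst sum.Sigma) (auto simp: case_prod_unfold)
  have sumJ: "(\<Sum>m=1..N. \<Sum>i<dim_vec (bh m). f m i) = (\<Sum>r\<in>J. f (fst r) (snd r))"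
    for f :: "nat \<Rightarrow> nat \<Rightarrow> real ^ 'd"
    unfolding J_def by (subst sum.Sigma) (auto simp: case_prod_unfold)
  define r0 s0 where "r0 = (l0, i0)" and "s0 = (m0, j0)"
  have r0: "r0 \<in> I" and s0: "s0 \<in> J" using l0 m0 by (auto simp: r0_def s0_def I_def J_def)
  define ah where "ah r s = Ah (fst r) (fst s) $$ (snd r, snd s)" for r s :: "nat \<times> nat"
  define al where "al s r = A (fst s) (fst r) $$ (snd s, snd r)" for r s :: "nat \<times> nat"
  define \<beta> where "\<beta> r = b (fst r) $v snd r" for r :: "nat \<times> nat"
  define \<gamma> where "\<gamma> s = bh (fst s) $v snd s" for s :: "nat \<times> nat"
  \<comment> \<open>The potential slopes \<open>k\<close> separate the kinetic stages, the kinetic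
    slopes \<open>l\<close> the potential ones.\<close>
  obtain k where k: "\<And>q. q \<in> {1..N} \<Longrightarrow> inj_on (\<lambda>i. \<Sum>s\<in>J. Ah q (fst s) $$ (i, snd s) * k s) {..<dim_vec (b q)}"
    using pgark_irreducible_separates_stages[OF irr] unfolding J_def by blast
  obtain l where l: "\<And>q. q \<in> {1..N} \<Longrightarrow> inj_on (\<lambda>i. \<Sum>s\<in>I. A q (fst s) $$ (i, snd s) * l s) {..<dim_vec (bh q)}"
    using pgark_irreducible_separates_stages[OF pgark_irreducible_swap[OF irr]] unfolding I_def by blast
  \<comment> \<open>\<open>x\<close> and \<open>y\<close> are the coordinates \<open>a\<close> of
    the kinetic and potential stage values at the initial value 0.\<close>
  define x where "x r = (\<Sum>s\<in>J. ah r s * k s)" for r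
  define y where "y s = (\<Sum>r\<in>I. al s r * l r)" for s
  have x_inj: "inj_on x {r \<in> I. fst r = q}" for q
  proof (rule inj_onI)
    fix r r' assume r: "r \<in> {r \<in> I. fst r = q}" "r' \<in> {r \<in> I. fst r = q}" "x r = x r'"
    then have "snd r = snd r'"
      by (intro inj_onD[OF k[of q]]) (auto simp: I_def x_def ah_def)
    with r show "r = r'" by (auto intro: prod_eqI)
  qed
  have y_inj: "inj_on y {s \<in> J. fst s = q}" for q
  proof (rule inj_onI)
    fix s s' assume s: "s \<in> {s \<in> J. fst s = q}" "s' \<in> {s \<in> J. fst s = q}" "y s = y s'"
    then have "snd s = snd s'"
      by (intro inj_onD[OF l[of q]]) (auto simp: J_def y_def al_def)
    with s show "s = s'" by (auto intro: prod_eqI)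
  qed
  \<comment> \<open>The slopes respond with rate 1 at stage \<open>r0\<close> and
    \<open>\<tau>\<close> at \<open>s0\<close>. The second condition makes the coupled equations of
    these two stages uniquely solvable; one of 1 and -1 always works.\<close>
  obtain \<tau> :: real where \<tau>: "\<tau> \<noteq> 0" "1 - ah r0 s0 * al s0 r0 * \<tau> \<noteq> 0"
  proof (cases "ah r0 s0 * al s0 r0 = 1")
    case True
    then show ?thesis using that[of "-1"] by simp
  next
    case False
    then show ?thesis using that[of 1] by simp
  qed
  obtain \<phi> \<phi>' \<epsilon>1 where \<phi>: "\<And>q k. D_k k (\<phi> q)" "\<And>q t. (\<phi> q has_real_derivative \<phi>' q t) (at t)" "0 < \<epsilon>1"
    "\<And>r t. r \<in> I \<Longrightarrow> \<bar>t - x r\<bar> < \<epsilon>1 \<Longrightarrow> \<phi>' (fst r) t = l r + (if r = r0 then 1 else 0) * (t - x r)"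
    using separated_potentials[of I x l "\<lambda>r. if r = r0 then 1 else 0", OF fin(1) x_inj] by blast
  \<comment> \<open>The signs of \<open>k\<close> and \<open>\<tau>\<close> are reversed because the
    slope of a potential stage is minus the gradient.\<close>
  obtain \<psi> \<psi>' \<epsilon>2 where \<psi>: "\<And>q k. D_k k (\<psi> q)" "\<And>q t. (\<psi> q has_real_derivative \<psi>' q t) (at t)" "0 < \<epsilon>2"
    "\<And>s t. s \<in> J \<Longrightarrow> \<bar>t - y s\<bar> < \<epsilon>2 \<Longrightarrow> \<psi>' (fst s) t = - k s + (if s = s0 then - \<tau> else 0) * (t - y s)"
    using separated_potentials[of J y "\<lambda>s. - k s" "\<lambda>s. if s = s0 then - \<tau> else 0", OF fin(2) y_inj] by blast
  fix a :: 'd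
  define T where "T m p = \<phi> m (p $ a)" for m and p :: "real ^ 'd"
  define V where "V m q = \<psi> m (q $ a)" for m and q :: "real ^ 'd"
  have smooth: "smooth (T m)" "smooth (V m)" for m
    unfolding T_def V_def by (rule smooth_component \<phi>(1) \<psi>(1))+
  have gradT: "grad (T m) p = axis a (\<phi>' m (p $ a))" for m p
    unfolding T_def by (rule grad_component[OF \<phi>(2)])
  have gradV: "grad (V m) q = axis a (\<psi>' m (q $ a))" for m q
    unfolding V_def by (rule grad_component[OF \<psi>(2)])

  \<comment> \<open>\<open>u\<close> and \<open>w\<close> are the deviations of stages
    \<open>r0\<close> and \<open>s0\<close> from \<open>x r0\<close> and \<open>y s0\<close> in
    coordinate \<open>a\<close>. The formulas solve the pair of equations given by
    \<open>u_eq\<close> and the definition of \<open>w\<close>.\<close>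
  define D where "D = inverse (1 - ah r0 s0 * al s0 r0 * \<tau>)"
  define u where "u z = D * (p_of z $ a + ah r0 s0 * \<tau> * q_of z $ a)" for z :: "real ^ ('d + 'd)"
  define w where "w z = q_of z $ a + al s0 r0 * u z" for z :: "real ^ ('d + 'd)"
  have u_eq: "u z = p_of z $ a + ah r0 s0 * (\<tau> * w z)" for z
  proof -
    have "u z * (1 - ah r0 s0 * al s0 r0 * \<tau>) = p_of z $ a + ah r0 s0 * \<tau> * q_of z $ a"
      using \<tau>(2) by (simp add: u_def D_def)
    then show ?thesis by (simp add: w_def algebra_simps)
  qed
  define P where "P q i z = p_of z + axis a (x (q, i) + ah (q, i) s0 * (\<tau> * w z))" for q i z
  define Q where "Q q i z = q_of z + axis a (y (q, i) + al (q, i) r0 * u z)" for q i z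
  have bl: "bounded_linear (\<lambda>z::real ^ ('d + 'd). p_of z $ a)" "bounded_linear (\<lambda>z::real ^ ('d + 'd). q_of z $ a)"
    using bounded_linear_compose[OF bounded_linear_vec_nth bounded_linear_p_of]
      bounded_linear_compose[OF bounded_linear_vec_nth bounded_linear_q_of] by auto
  have blu: "bounded_linear u"
    unfolding u_def by (intro bounded_linear_const_mult bounded_linear_add bl)
  have blw: "bounded_linear w"
    unfolding w_def by (intro bounded_linear_const_mult bounded_linear_add bl blu)
  note derivs = p_of_has_derivative[OF has_derivative_ident] q_of_has_derivative[OF has_derivative_ident]
    bounded_linear_imp_has_derivative[OF blu] bounded_linear_imp_has_derivative[OF blw]
  \<comment> \<open>Initial values for which every stage stays in the region where its gradient is
    affine.\<close>
  define U where "U = (\<Inter>r\<in>I. {z. \<bar>p_of z $ a + ah r s0 * (\<tau> * w z)\<bar> < \<epsilon>1})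
    \<inter> (\<Inter>s\<in>J. {z. \<bar>q_of z $ a + al s r0 * u z\<bar> < \<epsilon>2})"
  have "open U"
    unfolding U_def using fin
    by (intro open_Int open_INT ballI open_Collect_less continuous_intros
        bl[THEN linear_continuous_on] blu[THEN linear_continuous_on] blw[THEN linear_continuous_on])
  have "0 \<in> U" using \<phi>(3) \<psi>(3)
    by (simp add: U_def u_def w_def)
  \<comment> \<open>Every stage other than \<open>r0\<close> has a locally constant slope; at
    \<open>r0\<close> the slope varies by the deviation \<open>u\<close>.\<close>
  have L: "grad (T (fst r)) (P (fst r) (snd r) z) = axis a (l r + (if r = r0 then u z else 0))"
    if "r \<in> I" "z \<in> U" for r z
  proof -
    have "P (fst r) (snd r) z $ a - x r = p_of z $ a + ah r s0 * (\<tau> * w z)"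
      by (simp add: P_def)
    moreover have "\<bar>p_of z $ a + ah r s0 * (\<tau> * w z)\<bar> < \<epsilon>1"
      using that by (auto simp: U_def)
    ultimately show ?thesis
      using \<phi>(4)[OF that(1), of "P (fst r) (snd r) z $ a"] by (simp add: gradT u_eq)
  qed
  have K: "- grad (V (fst s)) (Q (fst s) (snd s) z) = axis a (k s + (if s = s0 then \<tau> * w z else 0))"
    if "s \<in> J" "z \<in> U" for s z
  proof -
    have "Q (fst s) (snd s) z $ a - y s = q_of z $ a + al s r0 * u z"
      by (simp add: Q_def)
    moreover have "\<bar>q_of z $ a + al s r0 * u z\<bar> < \<epsilon>2"
      using that by (auto simp: U_def)
    ultimately show ?thesis
      using \<psi>(4)[OF that(1), of "Q (fst s) (snd s) z $ a"] by (simp add: gradV uminus_axis w_def)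
  qed
  have sumL: "(\<Sum>r\<in>I. g r *\<^sub>R grad (T (fst r)) (P (fst r) (snd r) z)) = axis a ((\<Sum>r\<in>I. g r * l r) + g r0 * u z)"
    if "z \<in> U" for g z
    using that fin r0
    by (simp add: L sum_scaleR_axis distrib_left sum.distrib if_distrib[of "\<lambda>x. g _ * x"] cong: if_cong)
  have sumK: "(\<Sum>s\<in>J. g s *\<^sub>R - grad (V (fst s)) (Q (fst s) (snd s) z)) = axis a ((\<Sum>s\<in>J. g s * k s) + g s0 * (\<tau> * w z))"
    if "z \<in> U" for g z
  proof -
    have "(\<Sum>s\<in>J. g s *\<^sub>R - grad (V (fst s)) (Q (fst s) (snd s) z))
      = (\<Sum>s\<in>J. g s *\<^sub>R axis a (k s + (if s = s0 then \<tau> * w z else 0)))"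
      using that by (intro sum.cong) (simp_all only: K)
    then show ?thesis
      using fin s0
      by (simp add: sum_scaleR_axis distrib_left sum.distrib if_distrib[of "\<lambda>x. g _ * x"] cong: if_cong)
  qed
  have stages: "pgark_stages N A Ah b bh T V 1 (p_of z) (q_of z) (\<lambda>q i. P q i z) (\<lambda>q i. Q q i z)" if "z \<in> U" for z
    unfolding pgark_stages_def sumI sumJ sumL[OF that] sumK[OF that]
    by (simp add: P_def Q_def x_def y_def ah_def al_def)
  have "(P q i has_derivative (\<lambda>v. p_of v + axis a (0 + ah (q, i) s0 * (\<tau> * w v)))) (at z within U)" for q i z
    unfolding P_def
    by (intro has_derivative_add derivs has_derivative_const has_derivative_mult_right
        bounded_linear.has_derivative[OF bounded_linear_axis])
  then have diffP: "P q i differentiable_on U" for q i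
    unfolding differentiable_on_def differentiable_def by blast
  have "(Q q i has_derivative (\<lambda>v. q_of v + axis a (0 + al (q, i) r0 * u v))) (at z within U)" for q i z
    unfolding Q_def
    by (intro has_derivative_add derivs has_derivative_const has_derivative_mult_right
        bounded_linear.has_derivative[OF bounded_linear_axis])
  then have diffQ: "Q q i differentiable_on U" for q i
    unfolding differentiable_on_def differentiable_def by blast
  define \<Phi> where "\<Phi> z = pgark_result N b bh T V 1 (p_of z) (q_of z) (\<lambda>q i. P q i z) (\<lambda>q i. Q q i z)" for z
  have "symplectic_at \<Phi> 0"
    using symp[unfolded pgark_symplectic_def, rule_format, of T V U P Q 1 0]
      smooth \<open>open U\<close> \<open>0 \<in> U\<close> diffP diffQ stages unfolding \<Phi>_def by blast
  have \<Phi>_eq: "\<Phi> z = pq (p_of z + axis a ((\<Sum>s\<in>J. \<gamma> s * k s) + \<gamma> s0 * (\<tau> * w z)))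
      (q_of z + axis a ((\<Sum>r\<in>I. \<beta> r * l r) + \<beta> r0 * u z))" if "z \<in> U" for z
    unfolding \<Phi>_def pgark_result_def sumI sumJ sumL[OF that] sumK[OF that]
    by (simp add: \<beta>_def \<gamma>_def)
  define \<Phi>' where "\<Phi>' v = pq (p_of v + axis a (0 + \<gamma> s0 * (\<tau> * w v))) (q_of v + axis a (0 + \<beta> r0 * u v))" for v
  have "((\<lambda>z. pq (p_of z + axis a ((\<Sum>s\<in>J. \<gamma> s * k s) + \<gamma> s0 * (\<tau> * w z)))
      (q_of z + axis a ((\<Sum>r\<in>I. \<beta> r * l r) + \<beta> r0 * u z))) has_derivative \<Phi>') (at 0)"
    unfolding \<Phi>'_def
    by (intro pq_has_derivative has_derivative_add derivs has_derivative_const has_derivative_mult_right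
        bounded_linear.has_derivative[OF bounded_linear_axis])
  then have "(\<Phi> has_derivative \<Phi>') (at 0)"
    by (rule has_derivative_transform_within_open[OF _ \<open>open U\<close> \<open>0 \<in> U\<close>]) (simp add: \<Phi>_eq)
  \<comment> \<open>Only coordinate \<open>a\<close> of \<open>p\<close> and \<open>q\<close> is
    altered by the linear map, so the two unit vectors of this plane are the ones to test.\<close>
  with \<open>symplectic_at \<Phi> 0\<close>
  have "symp_form (\<Phi>' (pq (axis a 1) 0)) (\<Phi>' (pq 0 (axis a 1))) = symp_form (pq (axis a 1) 0) (pq 0 (axis a 1))"
    by (simp add: symplectic_at_iff)
  moreover have "axis a c \<bullet> axis a d = c * d" for c d :: real
    by (simp add: inner_axis_axis)
  moreover have "axis a c + axis a d = axis a (c + d)" for c d :: real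
    by (simp add: Finite_Cartesian_Product.vec_eq_iff axis_def)
  ultimately have "(1 + \<gamma> s0 * (\<tau> * (al s0 r0 * D))) * (1 + \<beta> r0 * (D * (ah r0 s0 * \<tau>)))
      - \<beta> r0 * D * (\<gamma> s0 * (\<tau> * (1 + al s0 r0 * (D * (ah r0 s0 * \<tau>))))) = 1"
    by (simp add: symp_form_def \<Phi>'_def u_def w_def)
  \<comment> \<open>The terms containing both \<open>ah\<close> and \<open>al\<close> cancel,
    leaving the determinant minus 1 as a nonzero multiple of the entry.\<close>
  then have "\<tau> * D * (ah r0 s0 * \<beta> r0 + \<gamma> s0 * al s0 r0 - \<gamma> s0 * \<beta> r0) = 0"
    by (simp add: algebra_simps)
  moreover have "D \<noteq> 0" using \<tau>(2) by (simp add: D_def)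
  ultimately show ?thesis
    using \<tau>(1) by (simp add: ah_def al_def \<beta>_def \<gamma>_def r0_def s0_def)
qed

text \<open>Both matrix conditions have the same entries up to transposition, and the two notions of
  symplecticity agree. All four implications thus reduce to one sufficiency and one necessity
  argument about the entries.\<close>

theorem corollary4p1:
  fixes N :: nat
    and s :: "nat \<Rightarrow> nat"
    and At A Ah :: "nat \<Rightarrow> nat \<Rightarrow> real mat"
    and bt b bh :: "nat \<Rightarrow> real Matrix.vec"
  assumes At_dim: "\<And>q m. q \<in> {1..2*N} \<Longrightarrow> m \<in> {1..2*N} \<Longrightarrow> At q m \<in> carrier_mat (s q) (s m)"
    and bt_dim: "\<And>m. m \<in> {1..2*N} \<Longrightarrow> bt m \<in> carrier_vec (s m)"
    and Ah: "\<And>l m. l \<in> {1..N} \<Longrightarrow> m \<in> {1..N} \<Longrightarrow> Ah l m = At l (N + m)"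
    and A: "\<And>l m. l \<in> {1..N} \<Longrightarrow> m \<in> {1..N} \<Longrightarrow> A l m = At (N + l) m"
    and bh: "\<And>m. m \<in> {1..N} \<Longrightarrow> bh m = bt (N + m)"
    and b: "\<And>m. m \<in> {1..N} \<Longrightarrow> b m = bt m"
  shows
    "((\<forall>l\<in>{1..N}. \<forall>m\<in>{N+1..2*N}. gark_P At bt l m = 0\<^sub>m (s l) (s m))
        \<longrightarrow> gark_symplectic TYPE('d::finite) N At bt)
   \<and> (pgark_irreducible N A Ah b bh \<and> gark_symplectic TYPE('d) N At bt
        \<longrightarrow> (\<forall>l\<in>{1..N}. \<forall>m\<in>{N+1..2*N}. gark_P At bt l m = 0\<^sub>m (s l) (s m)))
   \<and> ((\<forall>l\<in>{1..N}. \<forall>m\<in>{1..N}.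
          transpose_mat (Ah l m) * diag_of (b l) + diag_of (bh m) * A m l - outer (bh m) (b l)
            = 0\<^sub>m (s (N + m)) (s l))
        \<longrightarrow> pgark_symplectic TYPE('d) N A Ah b bh)
   \<and> (pgark_irreducible N A Ah b bh \<and> pgark_symplectic TYPE('d) N A Ah b bh
        \<longrightarrow> (\<forall>l\<in>{1..N}. \<forall>m\<in>{1..N}.
          transpose_mat (Ah l m) * diag_of (b l) + diag_of (bh m) * A m l - outer (bh m) (b l)
            = 0\<^sub>m (s (N + m)) (s l)))"
proof -
  \<comment> \<open>The common entrywise form of both conditions.\<close>
  define E where "E \<longleftrightarrow> (\<forall>l\<in>{1..N}. \<forall>m\<in>{1..N}. \<forall>i<dim_vec (b l). \<forall>j<dim_vec (bh m).
    Ah l m $$ (i, j) * b l $v i + bh m $v j * A m l $$ (j, i) - bh m $v j * b l $v i = 0)"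
  have dims: "dim_vec (b m) = s m" "dim_vec (bh m) = s (N + m)" if "m \<in> {1..N}" for m
    using that bt_dim[of m] bt_dim[of "N + m"] b bh by auto
  have Ah_dim: "Ah l m \<in> carrier_mat (dim_vec (b l)) (dim_vec (bh m))"
    and A_dim: "A m l \<in> carrier_mat (dim_vec (bh m)) (dim_vec (b l))"
    if "l \<in> {1..N}" "m \<in> {1..N}" for l m
    using that At_dim[of l "N + m"] At_dim[of "N + m" l] by (auto simp: Ah A dims)
  have pcond: "transpose_mat (Ah l m) * diag_of (b l) + diag_of (bh m) * A m l - outer (bh m) (b l)
      = 0\<^sub>m (s (N + m)) (s l) \<longleftrightarrow>
    (\<forall>i<dim_vec (b l). \<forall>j<dim_vec (bh m).
      Ah l m $$ (i, j) * b l $v i + bh m $v j * A m l $$ (j, i) - bh m $v j * b l $v i = 0)"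
    if "l \<in> {1..N}" "m \<in> {1..N}" for l m
    using coefficient_condition_iff[OF Ah_dim[OF that] A_dim[OF that]] that by (simp add: dims)
  have gcond: "gark_P At bt l (N + m) = 0\<^sub>m (s l) (s (N + m)) \<longleftrightarrow>
    (\<forall>i<dim_vec (b l). \<forall>j<dim_vec (bh m).
      Ah l m $$ (i, j) * b l $v i + bh m $v j * A m l $$ (j, i) - bh m $v j * b l $v i = 0)"
    if lm: "l \<in> {1..N}" "m \<in> {1..N}" for l m
  proof -
    \<comment> \<open>Transposition exchanges the two factors of each product and the first two
      summands.\<close>
    have swap: "A m l $$ (j, i) * bh m $v j + b l $v i * Ah l m $$ (i, j) - b l $v i * bh m $v j
        = Ah l m $$ (i, j) * b l $v i + bh m $v j * A m l $$ (j, i) - bh m $v j * b l $v i" for i j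
      by simp
    have P: "gark_P At bt l (N + m) =
        transpose_mat (A m l) * diag_of (bh m) + diag_of (b l) * Ah l m - outer (b l) (bh m)"
      using lm by (simp add: gark_P_def Ah A b bh)
    have "transpose_mat (A m l) * diag_of (bh m) + diag_of (b l) * Ah l m - outer (b l) (bh m)
        = 0\<^sub>m (s l) (s (N + m)) \<longleftrightarrow> (\<forall>j<dim_vec (bh m). \<forall>i<dim_vec (b l).
        A m l $$ (j, i) * bh m $v j + b l $v i * Ah l m $$ (i, j) - b l $v i * bh m $v j = 0)"
      using coefficient_condition_iff[OF A_dim[OF lm] Ah_dim[OF lm]] lm by (simp add: dims)
    then show ?thesis
      unfolding P swap by meson
  qed
  have range: "{N+1..2*N} = (+) N ` {1..N}" by (simp add: mult_2)
  have gark_cond: "(\<forall>l\<in>{1..N}. \<forall>m\<in>{N+1..2*N}. gark_P At bt l m = 0\<^sub>m (s l) (s m)) \<longleftrightarrow> E"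
    unfolding range ball_simps(9) E_def by (intro ball_cong refl gcond)
  have pgark_cond: "(\<forall>l\<in>{1..N}. \<forall>m\<in>{1..N}.
      transpose_mat (Ah l m) * diag_of (b l) + diag_of (bh m) * A m l - outer (bh m) (b l)
        = 0\<^sub>m (s (N + m)) (s l)) \<longleftrightarrow> E"
    unfolding E_def by (intro ball_cong refl pcond)
  have gark: "gark_symplectic TYPE('d) N At bt \<longleftrightarrow> pgark_symplectic TYPE('d) N A Ah b bh"
    using Ah A bh b by (rule gark_symplectic_iff_pgark_symplectic)
  have suff: "E \<Longrightarrow> pgark_symplectic TYPE('d) N A Ah b bh"
    unfolding E_def by (rule pgark_symplecticI) blast
  have nec: "E" if "pgark_irreducible N A Ah b bh" "pgark_symplectic TYPE('d) N A Ah b bh"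
    unfolding E_def using pgark_symplectic_imp_condition[OF that(2,1)] by blast
  show ?thesis
    unfolding gark_cond pgark_cond gark using suff nec by blast
qed

end
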